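(* Let $\alpha,\beta,v\in\mathbb R$ with $|\alpha-\beta|<|v|<\alpha+\beta+2$, let $W$ be the $2\times2$ Jacobi-type weight and $\mathcal V,\mathcal N$ the first-order differential operators defined in the context, and let $$D_1=\mathcal N\begin{pmatrix}1&0\\0&0\end{pmatrix}\mathcal V,\quad D_2=\mathcal N\begin{pmatrix}0&1\\0&0\end{pmatrix}\mathcal V,\quad D_3=\mathcal N\begin{pmatrix}0&0\\1&0\end{pmatrix}\mathcal V,\quad D_4=\mathcal N\begin{pmatrix}0&0\\0&1\end{pmatrix}\mathcal V.$$ Then the algebra $\mathcal D(W)$ is generated by the set $\{I,D_1,D_2,D_3,D_4\}$.
   Context: The weight: $W(x)=(1-x)^\alpha(1+x)^\beta\big(W_2\frac{(1-x)^2}{4}+W_1\frac{1-x}{2}+W_0\big)$ for $x\in(-1,1)$, where $$W_2=\begin{pmatrix}\frac{v(v+2+\alpha+\beta)}{v+\alpha-\beta}&0\\0&\frac{v(-v+2+\alpha+\beta)}{v-\alpha+\beta}\end{pmatrix},\quad W_1=\begin{pmatrix}-(v+\alpha+\beta+2)&\alpha+\beta+2\\\alpha+\beta+2&-(-v+\alpha+\beta+2)\end{pmatrix},\quad W_0=\begin{pmatrix}\alpha+1&-\alpha-1\\-\alpha-1&\alpha+1\end{pmatrix}.$$ The operators: $$\mathcal V=\partial\begin{pmatrix}x+\frac{\beta-\alpha}{v}&1+\frac{\beta-\alpha}{v}\\1+\frac{\alpha-\beta}{v}&x+\frac{\alpha-\beta}{v}\end{pmatrix}+\begin{pmatrix}\frac{v+2+\alpha+\beta}{2}&0\\0&\frac{-v+2+\alpha+\beta}{2}\end{pmatrix},$$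 $$\mathcal N=\partial\begin{pmatrix}-x+\frac{\beta-\alpha}{v}&1+\frac{\beta-\alpha}{v}\\1+\frac{\alpha-\beta}{v}&-x+\frac{\alpha-\beta}{v}\end{pmatrix}+\begin{pmatrix}-\frac12(-v+4+\alpha+\beta)&0\\0&-\frac12(\alpha+\beta+v+4)\end{pmatrix}.$$ Conventions: $\{P_n\}$ denotes the monic matrix polynomials orthogonal for $\langle P,Q\rangle_W=\int_{-1}^1P(x)W(x)Q(x)^*dx$. Matrix differential operators $D=\sum_j\partial^jF_j(x)$ with $F_j\in\operatorname{Mat}_2(\mathbb C[x])$, forming the algebra $\operatorname{Mat}_2(\Omega[x])$, act on the right: $P\cdot D=\sum_j\partial^j(P)F_j$, and $P\cdot(D_1D_2)=(P\cdot D_1)\cdot D_2$. $\mathcal D(W)=\{D\in\operatorname{Mat}_2(\Omega[x]):\text{for all }n\ge0,\ P_n\cdot D=\Lambda_n(D)P_n\text{ for some }\Lambda_n(D)\in\operatorname{Mat}_2(\mathbb C)\}$, an associative $\mathbb C$-algebra. *)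

theory Defs
  imports "HOL-Analysis.Analysis" "HOL-Computational_Algebra.Polynomial"
begin

section \<open>Matrix polynomials\<close>

type_synonym cmat = "complex^2^2"
type_synonym mpoly = "complex poly^2^2"

definition mat2 :: "'a::zero \<Rightarrow> 'a \<Rightarrow> 'a \<Rightarrow> 'a \<Rightarrow> 'a^2^2" where
  "mat2 a b c d = vector [vector [a, b], vector [c, d]]"

definition const_mpoly :: "cmat \<Rightarrow> mpoly" where
  "const_mpoly A = (\<chi> i j. [:A $ i $ j:])"

definition mcoeff :: "mpoly \<Rightarrow> nat \<Rightarrow> cmat" where
  "mcoeff P k = (\<chi> i j. coeff (P $ i $ j) k)"

definition meval :: "mpoly \<Rightarrow> real \<Rightarrow> cmat" where
  "meval P x = (\<chi> i j. poly (P $ i $ j) (complex_of_real x))"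

definition mderiv :: "mpoly \<Rightarrow> mpoly" where
  "mderiv P = (\<chi> i j. pderiv (P $ i $ j))"

definition ctranspose :: "cmat \<Rightarrow> cmat" where
  "ctranspose A = (\<chi> i j. cnj (A $ j $ i))"

definition monic_of_degree :: "nat \<Rightarrow> mpoly \<Rightarrow> bool" where
  "monic_of_degree n P \<longleftrightarrow> mcoeff P n = mat 1 \<and> (\<forall>k>n. mcoeff P k = 0)"


section \<open>Monic orthogonal polynomials of a matrix weight on the interval from -1 to 1\<close>

definition weight_inner :: "(real \<Rightarrow> cmat) \<Rightarrow> mpoly \<Rightarrow> mpoly \<Rightarrow> cmat" where
  "weight_inner W P Q =
     integral {-1<..<1} (\<lambda>x. meval P x ** W x ** ctranspose (meval Q x))"

definition monic_orthogonal_seq :: "(real \<Rightarrow> cmat) \<Rightarrow> (nat \<Rightarrow> mpoly) \<Rightarrow> bool" where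
  "monic_orthogonal_seq W P \<longleftrightarrow>
     (\<forall>n. monic_of_degree n (P n)) \<and>
     (\<forall>m n. m \<noteq> n \<longrightarrow> weight_inner W (P m) (P n) = 0)"

text \<open>For a weight that is positive definite almost everywhere and has finite moments, exactly
  one such sequence exists, and this definition denotes it.\<close>

definition monic_OP :: "(real \<Rightarrow> cmat) \<Rightarrow> nat \<Rightarrow> mpoly" where
  "monic_OP W = (THE P. monic_orthogonal_seq W P)"


section \<open>Matrix differential operators acting on the right\<close>

text \<open>An operator is represented by its action on matrix polynomials: the application
  \<open>D P\<close> stands for P acted upon from the right by D. Since the ground field has characteristic
  zero, an operator determines its coefficients (apart from trailing zeros in the list).\<close>

type_synonym mop = "mpoly \<Rightarrow> mpoly"

text \<open>The list \<open>[F\<^sub>0, F\<^sub>1, \<dots>]\<close> holds the coefficients of the operator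
  \<open>\<Sum>j. \<partial>\<^sup>j F\<^sub>j(x)\<close>, which have no degree restriction.\<close>

definition diff_op :: "mpoly list \<Rightarrow> mop" where
  "diff_op Fs = (\<lambda>P. \<Sum>j<length Fs. (mderiv ^^ j) P ** (Fs ! j))"

definition diff_ops :: "mop set" where
  "diff_ops = range diff_op"

definition const_op :: "cmat \<Rightarrow> mop" where
  "const_op A = diff_op [const_mpoly A]"

definition op_add :: "mop \<Rightarrow> mop \<Rightarrow> mop" where
  "op_add D E = (\<lambda>P. D P + E P)"

definition op_scale :: "complex \<Rightarrow> mop \<Rightarrow> mop" where
  "op_scale c D = (\<lambda>P. \<chi> i j. smult c (D P $ i $ j))"

text \<open>For a right action the left factor acts first, whence the reversed composition.\<close>

definition op_mult :: "mop \<Rightarrow> mop \<Rightarrow> mop"  (infixl "\<star>" 70) where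
  "D \<star> E = E \<circ> D"

inductive_set generated_algebra :: "mop set \<Rightarrow> mop set" for S where
  incl: "D \<in> S \<Longrightarrow> D \<in> generated_algebra S"
| zero: "(\<lambda>P. 0) \<in> generated_algebra S"
| add: "D \<in> generated_algebra S \<Longrightarrow> E \<in> generated_algebra S \<Longrightarrow> op_add D E \<in> generated_algebra S"
| scale: "D \<in> generated_algebra S \<Longrightarrow> op_scale c D \<in> generated_algebra S"
| mult: "D \<in> generated_algebra S \<Longrightarrow> E \<in> generated_algebra S \<Longrightarrow> D \<star> E \<in> generated_algebra S"

definition weight_algebra :: "(real \<Rightarrow> cmat) \<Rightarrow> mop set" where
  "weight_algebra W =
     {D \<in> diff_ops. \<forall>n. \<exists>\<Lambda>::cmat. D (monic_OP W n) = const_mpoly \<Lambda> ** monic_OP W n}"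


section \<open>The Jacobi-type weight and its first-order operators\<close>

definition rmat2 :: "real \<Rightarrow> real \<Rightarrow> real \<Rightarrow> real \<Rightarrow> cmat" where
  "rmat2 a b c d = mat2 (complex_of_real a) (complex_of_real b) (complex_of_real c) (complex_of_real d)"

definition jacobi_W2 :: "real \<Rightarrow> real \<Rightarrow> real \<Rightarrow> cmat" where
  "jacobi_W2 \<alpha> \<beta> v =
     rmat2 (v * (v + 2 + \<alpha> + \<beta>) / (v + \<alpha> - \<beta>)) 0
           0 (v * (- v + 2 + \<alpha> + \<beta>) / (v - \<alpha> + \<beta>))"

definition jacobi_W1 :: "real \<Rightarrow> real \<Rightarrow> real \<Rightarrow> cmat" where
  "jacobi_W1 \<alpha> \<beta> v =
     rmat2 (- (v + \<alpha> + \<beta> + 2)) (\<alpha> + \<beta> + 2)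
           (\<alpha> + \<beta> + 2) (- (- v + \<alpha> + \<beta> + 2))"

definition jacobi_W0 :: "real \<Rightarrow> cmat" where
  "jacobi_W0 \<alpha> = rmat2 (\<alpha> + 1) (- \<alpha> - 1) (- \<alpha> - 1) (\<alpha> + 1)"

definition jacobi_weight :: "real \<Rightarrow> real \<Rightarrow> real \<Rightarrow> real \<Rightarrow> cmat" where
  "jacobi_weight \<alpha> \<beta> v x =
     ((1 - x) powr \<alpha> * (1 + x) powr \<beta>) *\<^sub>R
       (((1 - x)\<^sup>2 / 4) *\<^sub>R jacobi_W2 \<alpha> \<beta> v + ((1 - x) / 2) *\<^sub>R jacobi_W1 \<alpha> \<beta> v + jacobi_W0 \<alpha>)"

text \<open>The real polynomial \<open>a + b x\<close>, used as a matrix entry.\<close>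

definition lin :: "real \<Rightarrow> real \<Rightarrow> complex poly" where
  "lin a b = [:complex_of_real a, complex_of_real b:]"

definition op_V :: "real \<Rightarrow> real \<Rightarrow> real \<Rightarrow> mop" where
  "op_V \<alpha> \<beta> v = diff_op
     [const_mpoly (rmat2 ((v + 2 + \<alpha> + \<beta>) / 2) 0
                         0 ((- v + 2 + \<alpha> + \<beta>) / 2)),
      mat2 (lin ((\<beta> - \<alpha>) / v) 1) (lin (1 + (\<beta> - \<alpha>) / v) 0)
           (lin (1 + (\<alpha> - \<beta>) / v) 0) (lin ((\<alpha> - \<beta>) / v) 1)]"

definition op_N :: "real \<Rightarrow> real \<Rightarrow> real \<Rightarrow> mop" where
  "op_N \<alpha> \<beta> v = diff_op
     [const_mpoly (rmat2 (- (1 / 2) * (- v + 4 + \<alpha> + \<beta>)) 0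
                         0 (- (1 / 2) * (\<alpha> + \<beta> + v + 4))),
      mat2 (lin ((\<beta> - \<alpha>) / v) (- 1)) (lin (1 + (\<beta> - \<alpha>) / v) 0)
           (lin (1 + (\<alpha> - \<beta>) / v) 0) (lin ((\<alpha> - \<beta>) / v) (- 1))]"

end

theory Submission
  imports Defs
begin

text \<open>The weight \<open>W\<close> is a Darboux transform of a scalar Jacobi weight. Put
  \<open>w(x) = (1 - x)\<^sup>\<alpha>\<^sup>+\<^sup>1 (1 + x)\<^sup>\<beta>\<^sup>+\<^sup>1\<close>, let \<open>p\<^sub>n\<close> be the monic orthogonal polynomials of \<open>w\<close> and
  \<open>\<lambda>\<^sub>n = n (n + \<alpha> + \<beta> + 3)\<close>; the Jacobi operator multiplies \<open>p\<^sub>n\<close> by \<open>-\<lambda>\<^sub>n\<close>. Integration by parts shows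
  that, up to a constant diagonal matrix, \<open>N\<close> is the adjoint of \<open>V\<close> between the inner products of \<open>w I\<close>
  and \<open>W\<close> (\<open>weight_inner_op_V\<close>). Moreover \<open>V\<close> followed by \<open>N\<close> acts on each entry as the Jacobi
  operator plus a constant that depends only on the column (\<open>op_N_op_V\<close>). Hence there are invertible
  diagonal matrices \<open>B\<^sub>n\<close>, \<open>A\<^sub>n\<close> with entries linear in \<open>n\<close> such that \<open>p\<^sub>n \<cdot> V = B\<^sub>n P\<^sub>n\<close>,
  \<open>P\<^sub>n \<cdot> N = A\<^sub>n p\<^sub>n\<close> and \<open>B\<^sub>n A\<^sub>n = diag(r\<^sub>1 - \<lambda>\<^sub>n, r\<^sub>2 - \<lambda>\<^sub>n)\<close>, where \<open>r\<^sub>1 \<noteq> r\<^sub>2\<close>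
  (\<open>monic_OP_eq\<close>, \<open>op_V_scalar_OP\<close>, \<open>op_N_matrix_OP\<close>).

  For a constant matrix \<open>E\<close> the operator \<open>N E V\<close> therefore has the eigenvalues \<open>A\<^sub>n E B\<^sub>n\<close> and lies in
  \<open>\<D>(W)\<close>. Multiplying by \<open>N E\<^sub>j\<^sub>j V\<close> on the right inserts the factor \<open>r\<^sub>j - \<lambda>\<^sub>n\<close>, so that the generated algebra
  contains an operator with eigenvalues \<open>A\<^sub>n M(\<lambda>\<^sub>n) B\<^sub>n\<close> for every matrix polynomial \<open>M\<close>
  (\<open>generated_matrix_polynomial\<close>).

  Conversely, let \<open>D \<in> \<D>(W)\<close> have eigenvalues \<open>\<Lambda>\<^sub>n\<close>. Leading coefficients show that \<open>\<Lambda>\<^sub>n\<close> is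
  polynomial in \<open>n\<close>. The operator \<open>V D N\<close> has the eigenfunctions \<open>p\<^sub>n\<close> with eigenvalues
  \<open>B\<^sub>n \<Lambda>\<^sub>n A\<^sub>n\<close>, and evaluation at \<open>x = 1\<close> shows that these are polynomial in \<open>\<lambda>\<^sub>n\<close>. Comparing the
  two facts at the roots of the entries of \<open>B\<^sub>n\<close> and \<open>A\<^sub>n\<close> yields
  \<open>\<Lambda>\<^sub>n = diag(q\<^sub>1, q\<^sub>2) + A\<^sub>n M(\<lambda>\<^sub>n) B\<^sub>n\<close> (\<open>eigenvalue_decomposition\<close>). After subtraction of a generated
  operator, \<open>D\<close> has the constant eigenvalues \<open>q = diag(q\<^sub>1, q\<^sub>2)\<close>, that is, \<open>V D = q V\<close>. Comparison of
  leading coefficients forces \<open>D\<close> to have order zero, and then \<open>q\<close> commutes with the coefficients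
  of \<open>V\<close>, whose off-diagonal entries do not vanish; so \<open>q\<^sub>1 = q\<^sub>2\<close>
  (\<open>constant_eigenvalues_scalar\<close>).\<close>


section \<open>Matrix polynomials and left-linear operators\<close>

lemma mat2_nth [simp]:
  "mat2 a b c d $ 1 $ 1 = a" "mat2 a b c d $ 1 $ 2 = b"
  "mat2 a b c d $ 2 $ 1 = c" "mat2 a b c d $ 2 $ 2 = d"
  by (simp_all add: mat2_def)

lemma mat2_eqI:
  fixes A B :: "'a^2^2"
  assumes "A $ 1 $ 1 = B $ 1 $ 1" "A $ 1 $ 2 = B $ 1 $ 2" "A $ 2 $ 1 = B $ 2 $ 1" "A $ 2 $ 2 = B $ 2 $ 2"
  shows "A = B"
  using assms by (simp add: vec_eq_iff forall_2)

lemma matrix_mult_nth2: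
  fixes A B :: "'a::semiring_1^2^2"
  shows "(A ** B) $ i $ j = A $ i $ 1 * B $ 1 $ j + A $ i $ 2 * B $ 2 $ j"
  by (simp add: matrix_matrix_mult_def sum_2)

lemma matrix_add_rdistrib': "(A + B) ** C = A ** C + B ** (C :: 'a::semiring_1^'n^'m)"
  by (simp add: matrix_matrix_mult_def vec_eq_iff sum.distrib distrib_right)

lemma matrix_mult_zero [simp]: "0 ** A = 0" "A ** 0 = (0 :: 'a::semiring_1^'n^'m)"
  by (simp_all add: matrix_matrix_mult_def vec_eq_iff)

lemma matrix_sum_left: "(\<Sum>i\<in>S. A i) ** B = (\<Sum>i\<in>S. A i ** (B :: 'a::semiring_1^'n^'m))"
  by (induction S rule: infinite_finite_induct) (simp_all add: matrix_add_rdistrib')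

lemma matrix_sum_right: "A ** (\<Sum>i\<in>S. B i) = (\<Sum>i\<in>S. A ** (B i :: 'a::semiring_1^'n^'m))"
  by (induction S rule: infinite_finite_induct) (simp_all add: matrix_add_ldistrib)

lemma const_mpoly_nth [simp]: "const_mpoly A $ i $ j = [:A $ i $ j:]"
  by (simp add: const_mpoly_def)

lemma const_mpoly_mult: "const_mpoly (A ** B) = const_mpoly A ** const_mpoly B"
  by (rule mat2_eqI) (simp_all add: matrix_mult_nth2)

lemma const_mpoly_add: "const_mpoly (A + B) = const_mpoly A + const_mpoly B"
  by (rule mat2_eqI) simp_all

lemma const_mpoly_zero [simp]: "const_mpoly 0 = 0"
  by (rule mat2_eqI) simp_all

lemma const_mpoly_one [simp]: "const_mpoly (mat 1) = mat 1"
  by (rule mat2_eqI) (simp_all add: mat_def one_pCons)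

lemma mderiv_nth [simp]: "mderiv P $ i $ j = pderiv (P $ i $ j)"
  by (simp add: mderiv_def)

lemma mderiv_add: "mderiv (P + Q) = mderiv P + mderiv Q"
  by (rule mat2_eqI) (simp_all add: pderiv_add)

lemma mderiv_mult: "mderiv (P ** Q) = mderiv P ** Q + P ** mderiv Q"
  by (rule mat2_eqI) (simp_all add: matrix_mult_nth2 pderiv_add pderiv_mult algebra_simps)

lemma mderiv_const [simp]: "mderiv (const_mpoly A) = 0"
  by (rule mat2_eqI) simp_all

lemma mderiv_zero [simp]: "mderiv 0 = 0"
  by (rule mat2_eqI) simp_all

lemma mderiv_sum: "mderiv (\<Sum>i\<in>S. f i) = (\<Sum>i\<in>S. mderiv (f i))"
  by (induction S rule: infinite_finite_induct) (simp_all add: mderiv_add)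

lemma mderiv_const_mult: "mderiv (const_mpoly A ** P) = const_mpoly A ** mderiv P"
  by (simp add: mderiv_mult)

lemma mderiv_pow_nth: "(mderiv ^^ j) P $ a $ b = (pderiv ^^ j) (P $ a $ b)"
  by (induction j) simp_all

lemma mcoeff_nth [simp]: "mcoeff P k $ i $ j = coeff (P $ i $ j) k"
  by (simp add: mcoeff_def)

lemma mcoeff_add: "mcoeff (P + Q) k = mcoeff P k + mcoeff Q k"
  by (rule mat2_eqI) simp_all

lemma mcoeff_diff: "mcoeff (P - Q) k = mcoeff P k - mcoeff Q k"
  by (rule mat2_eqI) simp_all

lemma mcoeff_const_mult: "mcoeff (const_mpoly A ** P) k = A ** mcoeff P k"
  by (rule mat2_eqI) (simp_all add: matrix_mult_nth2)

lemma mcoeff_sum: "mcoeff (\<Sum>i\<in>S. f i) k = (\<Sum>i\<in>S. mcoeff (f i) k)"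
  by (induction S rule: infinite_finite_induct) (simp_all add: mcoeff_add, simp_all add: vec_eq_iff)

lemma mpoly_eqI: "(\<And>k. mcoeff P k = mcoeff Q k) \<Longrightarrow> P = Q"
  by (simp add: vec_eq_iff poly_eq_iff)

text \<open>Operators act from the right, so they commute with multiplication by constant matrices from
  the left. Every identity between operators below is checked on one polynomial of each degree,
  which suffices for maps with this property.\<close>

definition left_linear :: "mop \<Rightarrow> bool" where
  "left_linear D \<longleftrightarrow>
     (\<forall>P Q. D (P + Q) = D P + D Q) \<and> (\<forall>A P. D (const_mpoly A ** P) = const_mpoly A ** D P)"

lemma left_linear_add: "left_linear D \<Longrightarrow> D (P + Q) = D P + D Q"
  and left_linear_const: "left_linear D \<Longrightarrow> D (const_mpoly A ** P) = const_mpoly A ** D P"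
  by (simp_all add: left_linear_def)

lemma left_linear_zero: "left_linear D \<Longrightarrow> D 0 = 0"
  using left_linear_add[of D 0 0] by simp

lemma left_linear_sum: "left_linear D \<Longrightarrow> D (\<Sum>i\<in>S. f i) = (\<Sum>i\<in>S. D (f i))"
  by (induction S rule: infinite_finite_induct) (simp_all add: left_linear_add left_linear_zero)

lemma left_linear_comp: "left_linear D \<Longrightarrow> left_linear E \<Longrightarrow> left_linear (\<lambda>P. E (D P))"
  by (simp add: left_linear_def)

lemma mderiv_pow_left_linear: "left_linear (mderiv ^^ j)"
  by (induction j) (simp_all add: left_linear_def mderiv_add mderiv_const_mult)

lemma left_linear_right_mult: "left_linear D \<Longrightarrow> left_linear (\<lambda>P. D P ** F)"
  by (simp add: left_linear_def matrix_add_rdistrib' matrix_mul_assoc)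

lemma left_linear_op_sum: "(\<And>i. i \<in> S \<Longrightarrow> left_linear (f i)) \<Longrightarrow> left_linear (\<lambda>P. \<Sum>i\<in>S. f i P)"
  by (simp add: left_linear_def sum.distrib matrix_sum_right)

lemma left_linear_diff_op: "left_linear (diff_op Fs)"
  unfolding diff_op_def
  by (intro left_linear_op_sum left_linear_right_mult mderiv_pow_left_linear)

lemma left_linear_diff_ops: "D \<in> diff_ops \<Longrightarrow> left_linear D"
  by (auto simp: diff_ops_def left_linear_diff_op)

text \<open>A sequence with one monic matrix polynomial in each degree is a basis of the left
  \<open>Mat\<^sub>2(\<complex>)\<close>-module of matrix polynomials, compatible with the filtration by degree.\<close>

lemma monic_sequence_expansion:
  assumes R: "\<And>n. monic_of_degree n (R n)"
  assumes "\<And>k. k \<ge> n \<Longrightarrow> mcoeff Q k = 0"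
  shows "\<exists>L. Q = (\<Sum>k<n. const_mpoly (L k) ** R k)"
  using assms(2)
proof (induction n arbitrary: Q)
  case 0
  then have "Q = 0" by (intro mpoly_eqI) (simp add: vec_eq_iff)
  then show ?case by simp
next
  case (Suc n)
  define Q' where "Q' = Q - const_mpoly (mcoeff Q n) ** R n"
  have "mcoeff Q' k = 0" if "k \<ge> n" for k
    using that R[of n] Suc.prems[of k]
    by (cases "k = n") (auto simp: Q'_def mcoeff_diff mcoeff_const_mult monic_of_degree_def)
  from Suc.IH[OF this] obtain L where L: "Q' = (\<Sum>k<n. const_mpoly (L k) ** R k)" by blast
  have "Q = (\<Sum>k<Suc n. const_mpoly ((L(n := mcoeff Q n)) k) ** R k)"
    using L by (simp add: Q'_def algebra_simps)
  then show ?case by blast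
qed

lemma mpoly_degree_bound: "\<exists>n. \<forall>k\<ge>n. mcoeff Q k = 0"
proof -
  define n where "n = Suc (\<Sum>i\<in>UNIV. \<Sum>j\<in>UNIV. degree (Q $ i $ j))"
  have "degree (Q $ i $ j) < n" for i j
  proof -
    have "degree (Q $ i $ j) \<le> (\<Sum>j\<in>UNIV. degree (Q $ i $ j))"
      by (rule member_le_sum) auto
    also have "\<dots> \<le> (\<Sum>i\<in>UNIV. \<Sum>j\<in>UNIV. degree (Q $ i $ j))"
      by (rule member_le_sum[of i UNIV "\<lambda>i. \<Sum>j\<in>UNIV. degree (Q $ i $ j)"]) auto
    finally show ?thesis by (simp add: n_def)
  qed
  then have "\<forall>k\<ge>n. mcoeff Q k = 0"
    by (auto simp: vec_eq_iff intro!: coeff_eq_0 intro: less_le_trans)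
  then show ?thesis by blast
qed

lemma left_linear_eqI:
  assumes "\<And>n. monic_of_degree n (R n)" and D: "left_linear D" and E: "left_linear E"
    and eq: "\<And>n. D (R n) = E (R n)"
  shows "D = E"
proof
  fix Q
  obtain n where "\<forall>k\<ge>n. mcoeff Q k = 0" using mpoly_degree_bound by blast
  then obtain L where "Q = (\<Sum>k<n. const_mpoly (L k) ** R k)"
    using monic_sequence_expansion[OF assms(1), of n Q] by blast
  then show "D Q = E Q"
    by (simp add: left_linear_sum D E left_linear_const eq)
qed


section \<open>Closure properties of the differential operators\<close>

lemma diff_ops_zero: "(\<lambda>P. 0) \<in> diff_ops"
  unfolding diff_ops_def by (rule range_eqI[of _ _ "[]"]) (simp add: diff_op_def)

text \<open>Padding with zero coefficients brings two operators to a common order before they are added.\<close>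

lemma diff_op_lengthen:
  assumes "n \<ge> length Fs"
  shows "diff_op Fs P = (\<Sum>j<n. (mderiv ^^ j) P ** (if j < length Fs then Fs ! j else 0))"
  unfolding diff_op_def using assms by (intro sum.mono_neutral_cong_left) auto

lemma diff_ops_add:
  assumes "D \<in> diff_ops" "E \<in> diff_ops"
  shows "(\<lambda>P. D P + E P) \<in> diff_ops"
proof -
  obtain Fs Gs where D: "D = diff_op Fs" and E: "E = diff_op Gs"
    using assms by (auto simp: diff_ops_def)
  let ?n = "max (length Fs) (length Gs)"
  define Hs where "Hs = map (\<lambda>j. (if j < length Fs then Fs ! j else 0) +
     (if j < length Gs then Gs ! j else 0)) [0..<?n]"
  have "D P + E P = diff_op Hs P" for P
    unfolding D E diff_op_lengthen[OF max.cobounded1[of "length Fs" "length Gs"]]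
      diff_op_lengthen[OF max.cobounded2[of "length Gs" "length Fs"]]
    unfolding sum.distrib[symmetric] diff_op_def Hs_def
    by (intro sum.cong) (simp_all add: matrix_add_ldistrib del: upt_Suc)
  then show ?thesis by (auto simp: diff_ops_def)
qed

lemma diff_ops_right_mult:
  assumes "D \<in> diff_ops"
  shows "(\<lambda>P. D P ** F) \<in> diff_ops"
proof -
  obtain Fs where D: "D = diff_op Fs" using assms by (auto simp: diff_ops_def)
  have "(\<lambda>P. D P ** F) = diff_op (map (\<lambda>G. G ** F) Fs)"
    by (simp add: D diff_op_def fun_eq_iff matrix_sum_left matrix_mul_assoc)
  then show ?thesis by (auto simp: diff_ops_def)
qed

lemma diff_ops_mderiv:
  assumes "D \<in> diff_ops"
  shows "(\<lambda>P. mderiv (D P)) \<in> diff_ops"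
proof -
  obtain Fs where D: "D = diff_op Fs" using assms by (auto simp: diff_ops_def)
  have "(\<lambda>P. diff_op (0 # Fs) P + diff_op (map mderiv Fs) P) \<in> diff_ops"
    by (rule diff_ops_add) (simp_all add: diff_ops_def)
  moreover have "mderiv (D P) = diff_op (0 # Fs) P + diff_op (map mderiv Fs) P" for P
    by (simp add: D diff_op_def mderiv_sum mderiv_mult sum.distrib sum.lessThan_Suc_shift
        del: sum.lessThan_Suc)
  ultimately show ?thesis by simp
qed

lemma diff_ops_sum:
  "(\<And>i. i \<in> S \<Longrightarrow> f i \<in> diff_ops) \<Longrightarrow> (\<lambda>P. \<Sum>i\<in>S. f i P) \<in> diff_ops"
  by (induction S rule: infinite_finite_induct) (simp_all add: diff_ops_zero diff_ops_add)

text \<open>By the Leibniz rule, \<open>diff_ops_mderiv\<close> makes each derivative of \<open>D P\<close> a differential operator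
  applied to \<open>P\<close>.\<close>

lemma diff_ops_mult:
  assumes "D \<in> diff_ops" "E \<in> diff_ops"
  shows "D \<star> E \<in> diff_ops"
proof -
  obtain Gs where E: "E = diff_op Gs" using assms by (auto simp: diff_ops_def)
  have "(\<lambda>P. (mderiv ^^ j) (D P)) \<in> diff_ops" for j
    by (induction j) (simp_all add: assms diff_ops_mderiv)
  then have "(\<lambda>P. \<Sum>j<length Gs. (mderiv ^^ j) (D P) ** Gs ! j) \<in> diff_ops"
    by (intro diff_ops_sum diff_ops_right_mult)
  then show ?thesis by (simp add: op_mult_def E diff_op_def comp_def)
qed

lemma op_scale_conv: "op_scale c D P = const_mpoly (mat c) ** D P"
  by (rule mat2_eqI) (simp_all add: op_scale_def matrix_mult_nth2 mat_def)

lemma op_scale_conv_right: "op_scale c D P = D P ** const_mpoly (mat c)"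
  by (rule mat2_eqI) (simp_all add: op_scale_def matrix_mult_nth2 mat_def)

lemma diff_ops_scale: "D \<in> diff_ops \<Longrightarrow> op_scale c D \<in> diff_ops"
  using diff_ops_right_mult[of D "const_mpoly (mat c)"]
  by (simp add: op_scale_conv_right[abs_def])

lemma const_op_apply: "const_op A P = P ** const_mpoly A"
  by (simp add: const_op_def diff_op_def)

lemma const_op_diff_ops: "const_op A \<in> diff_ops"
  by (simp add: const_op_def diff_ops_def)

lemma op_mult_apply: "(D \<star> E) P = E (D P)"
  by (simp add: op_mult_def)

lemma first_order_apply: "diff_op [F0, F1] P = P ** F0 + mderiv P ** F1"
  by (simp add: diff_op_def)

section \<open>The scalar Jacobi functional\<close>

definition jacobi_functional :: "real \<Rightarrow> real \<Rightarrow> complex poly \<Rightarrow> complex" where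
  "jacobi_functional a b h =
     integral {-1<..<1} (\<lambda>x. ((1 - x) powr a * (1 + x) powr b) *\<^sub>R poly h (complex_of_real x))"

abbreviation conj_poly :: "complex poly \<Rightarrow> complex poly" where
  "conj_poly \<equiv> map_poly cnj"

lemma poly_conj_poly_of_real: "poly (conj_poly p) (complex_of_real x) = cnj (poly p (complex_of_real x))"
  by (induction p) (simp_all add: map_poly_pCons)

lemma conj_poly_add: "conj_poly (p + q) = conj_poly p + conj_poly q"
  by (rule poly_eqI) (simp add: coeff_map_poly)

lemma conj_poly_mult: "conj_poly (p * q) = conj_poly p * conj_poly q"
  by (rule poly_eqI) (simp add: coeff_map_poly coeff_mult)

lemma conj_poly_pderiv: "conj_poly (pderiv p) = pderiv (conj_poly p)"
  by (rule poly_eqI) (simp add: coeff_map_poly coeff_pderiv)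

text \<open>An affine substitution turns the integral over the interval from 0 to 1 that defines Euler's
  beta function into this one.\<close>

lemma jacobi_weight_integrable:
  assumes "a > -1" "b > -1"
  shows "(\<lambda>x::real. (1 - x) powr a * (1 + x) powr b) integrable_on {-1<..<1}"
proof -
  have "(\<lambda>t. t powr b * (1 - t) powr a) integrable_on {0..1}"
    using integrable_Beta'[of "b + 1" "a + 1"] assms by simp
  then obtain I where "((\<lambda>t. t powr b * (1 - t) powr a) has_integral I) (cbox 0 1)"
    by (auto simp: integrable_on_def)
  from has_integral_affinity[OF this, of "1/2" "1/2"]
  have *: "((\<lambda>x. (x / 2 + 1 / 2) powr b * (1 / 2 - x / 2) powr a) has_integral 2 * I) ((\<lambda>x. 2 * x - 1) ` {0..1})"
    by (simp add: algebra_simps)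
  have img: "(\<lambda>x::real. 2 * x - 1) ` {0..1} = {-1..1}"
  proof
    show "{-1..1} \<subseteq> (\<lambda>x::real. 2 * x - 1) ` {0..1}"
    proof
      fix y :: real assume "y \<in> {-1..1}"
      then show "y \<in> (\<lambda>x::real. 2 * x - 1) ` {0..1}"
        by (intro image_eqI[of _ _ "(y + 1) / 2"]) (auto simp: field_simps)
    qed
  qed auto
  have "(\<lambda>x. 2 powr (a + b) * ((x / 2 + 1 / 2) powr b * (1 / 2 - x / 2) powr a)) integrable_on {-1<..<1}"
    using * unfolding img has_integral_Icc_iff_Ioo
    by (intro integrable_on_mult_right) (auto simp: integrable_on_def)
  then show ?thesis
  proof (rule integrable_eq)
    fix x :: real assume x: "x \<in> {-1<..<1}"
    have "(x / 2 + 1 / 2) powr b = (1 + x) powr b / 2 powr b"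
      using x powr_divide[of "1 + x" 2 b] by (simp add: add_divide_distrib add.commute)
    moreover have "(1 / 2 - x / 2) powr a = (1 - x) powr a / 2 powr a"
      using x powr_divide[of "1 - x" 2 a] by (simp add: diff_divide_distrib)
    ultimately show "2 powr (a + b) * ((x / 2 + 1 / 2) powr b * (1 / 2 - x / 2) powr a) =
        (1 - x) powr a * (1 + x) powr b"
      by (simp add: powr_add)
  qed
qed

text \<open>Since \<open>x h = (1 + x) h - h\<close> and the factor \<open>1 + x\<close> raises the exponent \<open>b\<close> by one, the
  induction on the polynomial has to leave \<open>b\<close> free.\<close>

lemma jacobi_integrable:
  assumes "a > -1" "b > -1"
  shows "(\<lambda>x. ((1 - x) powr a * (1 + x) powr b) *\<^sub>R poly h (complex_of_real x)) integrable_on {-1<..<1}"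
  using assms
proof (induction h arbitrary: b)
  case 0
  show ?case by (simp add: integrable_0)
next
  case (pCons c h)
  have c: "(\<lambda>x. ((1 - x) powr a * (1 + x) powr b) *\<^sub>R c) integrable_on {-1<..<1}"
    using integrable_linear[OF jacobi_weight_integrable[OF pCons.prems] bounded_linear_scaleR_left[of c]]
    by (simp add: comp_def)
  have "(\<lambda>x. ((1 - x) powr a * (1 + x) powr b) *\<^sub>R c +
      (((1 - x) powr a * (1 + x) powr (b + 1)) *\<^sub>R poly h (complex_of_real x) -
       ((1 - x) powr a * (1 + x) powr b) *\<^sub>R poly h (complex_of_real x))) integrable_on {-1<..<1}"
    using pCons.prems by (intro integrable_add integrable_diff c pCons.IH) auto
  then show ?case
    by (rule integrable_eq) (auto simp: powr_add scaleR_conv_of_real algebra_simps)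
qed

context
  fixes a b :: real
  assumes ab: "a > -1" "b > -1"
begin

lemma jacobi_functional_has_integral:
  "((\<lambda>x. ((1 - x) powr a * (1 + x) powr b) *\<^sub>R poly h (complex_of_real x))
     has_integral jacobi_functional a b h) {-1<..<1}"
  unfolding jacobi_functional_def by (rule integrable_integral[OF jacobi_integrable[OF ab]])

lemma jacobi_functional_add:
  "jacobi_functional a b (f + g) = jacobi_functional a b f + jacobi_functional a b g"
proof -
  have "((\<lambda>x. ((1 - x) powr a * (1 + x) powr b) *\<^sub>R poly (f + g) (complex_of_real x))
     has_integral (jacobi_functional a b f + jacobi_functional a b g)) {-1<..<1}"
    using has_integral_add[OF jacobi_functional_has_integral[of f] jacobi_functional_has_integral[of g]]
    by (simp add: scaleR_add_right)
  then show ?thesis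
    unfolding jacobi_functional_def[of a b "f + g"] by (rule integral_unique)
qed

lemma jacobi_functional_smult:
  "jacobi_functional a b (smult c f) = c * jacobi_functional a b f"
proof -
  have "((\<lambda>x. ((1 - x) powr a * (1 + x) powr b) *\<^sub>R poly (smult c f) (complex_of_real x))
     has_integral (c * jacobi_functional a b f)) {-1<..<1}"
    using has_integral_mult_right[OF jacobi_functional_has_integral[of f], of c]
    by simp
  then show ?thesis
    unfolding jacobi_functional_def[of a b "smult c f"] by (rule integral_unique)
qed

text \<open>The derivative of \<open>(1 - x)\<^sup>a\<^sup>+\<^sup>1 (1 + x)\<^sup>b\<^sup>+\<^sup>1 g\<close> has integral zero because this function
  vanishes at both endpoints. Every integration by parts below is an instance of this
  identity, stated for polynomials.\<close>

lemma jacobi_functional_pearson: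
  "jacobi_functional a b (pderiv g * [:1, 0, -1:] + g * lin (b - a) (- (a + b + 2))) = 0"
proof -
  define F where "F = (\<lambda>x::real. ((1 - x) powr (a + 1) * (1 + x) powr (b + 1)) *\<^sub>R poly g (complex_of_real x))"
  define f where "f = (\<lambda>x::real. ((1 - x) powr a * (1 + x) powr b) *\<^sub>R
     poly (pderiv g * [:1, 0, -1:] + g * lin (b - a) (- (a + b + 2))) (complex_of_real x))"
  have cont: "continuous_on {-1..1} F"
    unfolding F_def using ab
    by (intro continuous_intros continuous_on_powr') auto
  have "(F has_vector_derivative f x) (at x)" if x: "x \<in> {-1<..<1}" for x
  proof -
    have "((\<lambda>x. (1 - x) powr (a + 1) * (1 + x) powr (b + 1)) has_real_derivative
        (1 - x) powr a * (1 + x) powr b * ((b + 1) * (1 - x) - (a + 1) * (1 + x))) (at x)"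
    proof -
      have "((\<lambda>x. (1 - x) powr (a + 1)) has_real_derivative (a + 1) * (1 - x) powr a * (- 1)) (at x)"
        by (rule DERIV_chain2[where f = "\<lambda>y. y powr (a + 1)" and g = "\<lambda>x. 1 - x"])
          (use x has_real_derivative_powr[of "1 - x" "a + 1"] in \<open>auto intro!: derivative_eq_intros\<close>)
      moreover have "((\<lambda>x. (1 + x) powr (b + 1)) has_real_derivative (b + 1) * (1 + x) powr b * 1) (at x)"
        by (rule DERIV_chain2[where f = "\<lambda>y. y powr (b + 1)" and g = "\<lambda>x. 1 + x"])
          (use x has_real_derivative_powr[of "1 + x" "b + 1"] in \<open>auto intro!: derivative_eq_intros\<close>)
      ultimately show ?thesis
        by (rule DERIV_cong[OF DERIV_mult]) (use x in \<open>simp add: powr_add algebra_simps\<close>)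
    qed
    moreover have "((\<lambda>x. poly g (complex_of_real x)) has_vector_derivative poly (pderiv g) (complex_of_real x)) (at x)"
      by (rule has_vector_derivative_real_field) (rule poly_DERIV)
    ultimately have "(F has_vector_derivative
        ((1 - x) powr (a + 1) * (1 + x) powr (b + 1)) *\<^sub>R poly (pderiv g) (complex_of_real x) +
        ((1 - x) powr a * (1 + x) powr b * ((b + 1) * (1 - x) - (a + 1) * (1 + x))) *\<^sub>R
          poly g (complex_of_real x)) (at x)"
      unfolding F_def by (rule has_vector_derivative_scaleR)
    also have "((1 - x) powr (a + 1) * (1 + x) powr (b + 1)) *\<^sub>R poly (pderiv g) (complex_of_real x) +
        ((1 - x) powr a * (1 + x) powr b * ((b + 1) * (1 - x) - (a + 1) * (1 + x))) *\<^sub>R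
          poly g (complex_of_real x) = f x"
      using x by (simp add: f_def lin_def powr_add scaleR_conv_of_real algebra_simps)
    finally show ?thesis .
  qed
  from fundamental_theorem_of_calculus_interior[OF _ cont this]
  have "(f has_integral (F 1 - F (-1))) {-1..1}" by simp
  then have "(f has_integral 0) {-1<..<1}"
    by (simp add: has_integral_Icc_iff_Ioo F_def)
  then show ?thesis
    unfolding f_def jacobi_functional_def by (rule integral_unique)
qed

text \<open>The integrand is \<open>(1 - x)\<^sup>a\<^sup>+\<^sup>1 (1 + x)\<^sup>b\<^sup>+\<^sup>1 |p(x)|\<^sup>2\<close>, which is continuous and nonnegative; were its
  integral zero, \<open>p\<close> would vanish on the whole interval.\<close>

lemma jacobi_functional_norm_nonzero:
  assumes "p \<noteq> 0"
  shows "jacobi_functional a b ([:1, 0, -1:] * (p * conj_poly p)) \<noteq> 0"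
proof
  assume zero: "jacobi_functional a b ([:1, 0, -1:] * (p * conj_poly p)) = 0"
  define f where "f = (\<lambda>x::real. ((1 - x) powr (a + 1) * (1 + x) powr (b + 1)) * (cmod (poly p (complex_of_real x)))\<^sup>2)"
  have cont: "continuous_on (cbox (-1) 1) f"
    unfolding f_def using ab by (intro continuous_intros continuous_on_powr') auto
  have eq: "((1 - x) powr a * (1 + x) powr b) *\<^sub>R poly ([:1, 0, -1:] * (p * conj_poly p)) (complex_of_real x)
      = complex_of_real (f x)" if "x \<in> {-1<..<1}" for x
  proof -
    define z where "z = poly p (complex_of_real x)"
    have "((1 - x) powr a * (1 + x) powr b) *\<^sub>R poly ([:1, 0, -1:] * (p * conj_poly p)) (complex_of_real x)
        = of_real ((1 - x) powr a * (1 + x) powr b * ((1 - x) * (1 + x))) * (z * cnj z)"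
      by (simp add: z_def scaleR_conv_of_real poly_conj_poly_of_real algebra_simps)
    also have "\<dots> = complex_of_real (f x)"
      using that by (simp add: f_def powr_add z_def flip: complex_norm_square)
    finally show ?thesis .
  qed
  have "((\<lambda>x. complex_of_real (f x)) has_integral 0) {-1<..<1}"
    using has_integral_eq[OF eq jacobi_functional_has_integral] zero by simp
  from has_integral_linear[OF this bounded_linear_Re]
  have int: "(f has_integral 0) (cbox (-1) 1)"
    by (simp add: comp_def has_integral_Icc_iff_Ioo)
  have f0: "f x = 0" if "x \<in> cbox (-1) 1" for x
    by (rule has_integral_0_cbox_imp_0[OF cont _ int _ that]) (auto simp: f_def)
  have "poly p (complex_of_real x) = 0" if "x \<in> {-1<..<1}" for x
    using that f0[of x] by (auto simp: f_def)
  then have "complex_of_real ` {-1<..<1} \<subseteq> {z. poly p z = 0}" by auto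
  then have "finite (complex_of_real ` {-1<..<1})"
    using poly_roots_finite[OF assms] finite_subset by blast
  then have "finite {-1<..<1::real}"
    by (rule finite_imageD) (simp add: inj_on_def)
  then show False
    using infinite_Ioo[of "-1::real" 1] by simp
qed

end

section \<open>The matrix inner product as a functional on polynomials\<close>

definition adj_mpoly :: "mpoly \<Rightarrow> mpoly" where
  "adj_mpoly P = (\<chi> i j. conj_poly (P $ j $ i))"

lemma adj_mpoly_nth [simp]: "adj_mpoly P $ i $ j = conj_poly (P $ j $ i)"
  by (simp add: adj_mpoly_def)

lemma adj_mpoly_add: "adj_mpoly (P + Q) = adj_mpoly P + adj_mpoly Q"
  by (rule mat2_eqI) (simp_all add: conj_poly_add)

lemma adj_mpoly_mult: "adj_mpoly (P ** Q) = adj_mpoly Q ** adj_mpoly P"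
  by (rule mat2_eqI) (simp_all add: matrix_mult_nth2 conj_poly_add conj_poly_mult mult.commute)

lemma adj_mpoly_mderiv: "adj_mpoly (mderiv P) = mderiv (adj_mpoly P)"
  by (rule mat2_eqI) (simp_all add: conj_poly_pderiv)

lemma adj_mpoly_const: "adj_mpoly (const_mpoly A) = const_mpoly (ctranspose A)"
  by (rule mat2_eqI) (simp_all add: map_poly_pCons ctranspose_def)

definition matrix_functional :: "(complex poly \<Rightarrow> complex) \<Rightarrow> mpoly \<Rightarrow> cmat" where
  "matrix_functional L P = (\<chi> i j. L (P $ i $ j))"

lemma matrix_functional_nth [simp]: "matrix_functional L P $ i $ j = L (P $ i $ j)"
  by (simp add: matrix_functional_def)

lemma has_integral_matrix:
  fixes f :: "real \<Rightarrow> cmat"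
  assumes "\<And>i j. ((\<lambda>x. f x $ i $ j) has_integral (I $ i $ j)) S"
  shows "(f has_integral I) S"
  unfolding has_integral_componentwise_iff[of f]
proof
  fix u :: cmat assume "u \<in> Basis"
  then obtain i w where w: "w \<in> Basis" and u: "u = axis i w"
    by (auto simp: Basis_vec_def)
  from w obtain j z where z: "w = axis j z"
    by (auto simp: Basis_vec_def)
  have "((\<lambda>x. inner (f x $ i $ j) z) has_integral (inner (I $ i $ j) z)) S"
    using has_integral_linear[OF assms bounded_linear_inner_left[of z]] by (simp add: comp_def)
  then show "((\<lambda>x. inner (f x) u) has_integral (inner I u)) S"
    by (simp add: u z inner_axis)
qed

lemma meval_nth [simp]: "meval P x $ i $ j = poly (P $ i $ j) (complex_of_real x)"
  by (simp add: meval_def)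

text \<open>All later computations with the inner product happen on the polynomial side of this equation,
  where no question of integrability arises.\<close>

lemma weight_inner_eq_functional:
  assumes "a > -1" "b > -1"
    and W: "\<And>x. W x = ((1 - x) powr a * (1 + x) powr b) *\<^sub>R meval M x"
  shows "weight_inner W P Q = matrix_functional (jacobi_functional a b) (P ** M ** adj_mpoly Q)"
  unfolding weight_inner_def
proof (rule integral_unique, rule has_integral_matrix)
  fix i j
  have "(meval P x ** W x ** ctranspose (meval Q x)) $ i $ j =
      ((1 - x) powr a * (1 + x) powr b) *\<^sub>R poly ((P ** M ** adj_mpoly Q) $ i $ j) (complex_of_real x)" for x
    by (simp add: matrix_mult_nth2 W ctranspose_def poly_conj_poly_of_real)
      (simp add: scaleR_conv_of_real algebra_simps)
  then show "((\<lambda>x. (meval P x ** W x ** ctranspose (meval Q x)) $ i $ j) has_integral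
      (matrix_functional (jacobi_functional a b) (P ** M ** adj_mpoly Q)) $ i $ j) {-1<..<1}"
    using jacobi_functional_has_integral[OF assms(1,2), of "(P ** M ** adj_mpoly Q) $ i $ j"] by simp
qed

section \<open>Scalar Jacobi polynomials\<close>

text \<open>The eigenvalue of the second-order Jacobi operator for the exponents \<open>a + 1\<close> and \<open>b + 1\<close> is
  minus this quantity.\<close>

definition jacobi_eigenvalue :: "real \<Rightarrow> real \<Rightarrow> nat \<Rightarrow> complex" where
  "jacobi_eigenvalue a b n = of_nat n * (of_nat n + of_real (a + b + 3))"

definition jacobi_denominator :: "real \<Rightarrow> nat \<Rightarrow> complex" where
  "jacobi_denominator a i = of_real (2 * (real i + 1) * (real i + a + 2))"

text \<open>In powers of \<open>x - 1\<close> the hypergeometric form of the Jacobi polynomial of degree \<open>n\<close> has as its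
  \<open>j\<close>-th coefficient the value of this polynomial at the \<open>n\<close>-th eigenvalue. The product vanishes there
  as soon as \<open>j > n\<close>.\<close>

definition jacobi_coeff :: "real \<Rightarrow> real \<Rightarrow> nat \<Rightarrow> complex poly" where
  "jacobi_coeff a b j =
     (\<Prod>i<j. smult (1 / jacobi_denominator a i) [:- jacobi_eigenvalue a b i, 1:])"

text \<open>The Jacobi polynomial in the variable \<open>x - 1\<close>.\<close>

definition jacobi_shifted :: "real \<Rightarrow> real \<Rightarrow> nat \<Rightarrow> complex poly" where
  "jacobi_shifted a b n = (\<Sum>k\<le>n. monom (poly (jacobi_coeff a b k) (jacobi_eigenvalue a b n)) k)"

definition jacobi_poly :: "real \<Rightarrow> real \<Rightarrow> nat \<Rightarrow> complex poly" where
  "jacobi_poly a b n = pcompose (jacobi_shifted a b n) [:-1, 1:]"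

definition jacobi_op :: "real \<Rightarrow> real \<Rightarrow> complex poly \<Rightarrow> complex poly" where
  "jacobi_op a b p = [:1, 0, -1:] * pderiv (pderiv p) + lin (b - a) (- (a + b + 4)) * pderiv p"

lemma jacobi_eigenvalue_real: "jacobi_eigenvalue a b n = of_real (real n * (real n + (a + b + 3)))"
  by (simp add: jacobi_eigenvalue_def)

lemma jacobi_eigenvalue_inj:
  assumes ab: "a > -1" "b > -1" and "m \<noteq> n"
  shows "jacobi_eigenvalue a b m \<noteq> jacobi_eigenvalue a b n"
proof
  assume "jacobi_eigenvalue a b m = jacobi_eigenvalue a b n"
  then have "real m * (real m + (a + b + 3)) = real n * (real n + (a + b + 3))"
    unfolding jacobi_eigenvalue_real of_real_eq_iff .
  then have "(real m - real n) * (real m + real n + (a + b + 3)) = 0"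
    by (simp add: algebra_simps)
  then show False using assms by (simp add: add_nonneg_eq_0_iff)
qed

lemma poly_jacobi_coeff_eq_0:
  assumes "n < j"
  shows "poly (jacobi_coeff a b j) (jacobi_eigenvalue a b n) = 0"
  using assms unfolding jacobi_coeff_def poly_prod
  by (intro prod_zero) (auto intro!: bexI[of _ n])

lemma coeff_jacobi_shifted:
  "coeff (jacobi_shifted a b n) k = poly (jacobi_coeff a b k) (jacobi_eigenvalue a b n)"
  by (simp add: jacobi_shifted_def coeff_sum poly_jacobi_coeff_eq_0)

lemma jacobi_denominator_nonzero:
  assumes "a > -1"
  shows "jacobi_denominator a i \<noteq> 0"
proof -
  have "2 * (real i + 1) * (real i + a + 2) \<noteq> 0" using assms by simp
  then show ?thesis unfolding jacobi_denominator_def of_real_eq_0_iff .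
qed

lemma poly_jacobi_coeff_Suc:
  assumes "a > -1"
  shows "(jacobi_eigenvalue a b n - jacobi_eigenvalue a b k) * poly (jacobi_coeff a b k) (jacobi_eigenvalue a b n)
    = jacobi_denominator a k * poly (jacobi_coeff a b (Suc k)) (jacobi_eigenvalue a b n)"
  using jacobi_denominator_nonzero[OF assms, of k]
  by (simp add: jacobi_coeff_def field_simps)

text \<open>In the variable \<open>x - 1\<close> the differential equation is a two-term recursion for the coefficients,
  namely \<open>poly_jacobi_coeff_Suc\<close>.\<close>

lemma jacobi_shifted_equation:
  fixes a b :: real and n :: nat
  assumes "a > -1"
  defines "g \<equiv> jacobi_shifted a b n"
  shows "[:0, -2, -1:] * pderiv (pderiv g) + lin (- 2 * (a + 2)) (- (a + b + 4)) * pderiv g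
    = smult (- jacobi_eigenvalue a b n) g"
proof (rule poly_eqI)
  fix k
  have "coeff ([:0, -2, -1:] * pderiv (pderiv g) + lin (- 2 * (a + 2)) (- (a + b + 4)) * pderiv g) k
     = - jacobi_eigenvalue a b k * coeff g k - jacobi_denominator a k * coeff g (Suc k)"
    by (cases k; cases "k - 1")
      (auto simp: coeff_pderiv lin_def jacobi_eigenvalue_def jacobi_denominator_def algebra_simps)
  also have "\<dots> = coeff (smult (- jacobi_eigenvalue a b n) g) k"
    using poly_jacobi_coeff_Suc[OF assms(1), of b n k]
    by (simp add: g_def coeff_jacobi_shifted algebra_simps)
  finally show "coeff ([:0, -2, -1:] * pderiv (pderiv g) + lin (- 2 * (a + 2)) (- (a + b + 4)) * pderiv g) k
    = coeff (smult (- jacobi_eigenvalue a b n) g) k" .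
qed

lemma pderiv_shift: "pderiv (pcompose p [:-1, 1:]) = pcompose (pderiv p) [:-1, 1 :: complex:]"
  by (simp add: pderiv_pcompose pderiv_pCons)

lemma jacobi_op_jacobi_poly:
  assumes "a > -1"
  shows "jacobi_op a b (jacobi_poly a b n) = smult (- jacobi_eigenvalue a b n) (jacobi_poly a b n)"
proof -
  have *: "[:1, 0, -1:] = pcompose [:0, -2, -1:] [:-1, 1 :: complex:]"
    "lin (b - a) (- (a + b + 4)) = pcompose (lin (- 2 * (a + 2)) (- (a + b + 4))) [:-1, 1:]"
    by (simp_all add: pcompose_pCons lin_def)
  show ?thesis
    unfolding jacobi_op_def jacobi_poly_def pderiv_shift *
    unfolding pcompose_mult[symmetric] pcompose_add[symmetric] pcompose_smult[symmetric]
      jacobi_shifted_equation[OF assms] ..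
qed

lemma coeff_higher_pderiv:
  "fact k * coeff ((pderiv ^^ j) p) k = fact (k + j) * coeff (p :: complex poly) (k + j)"
proof (induction j arbitrary: k)
  case (Suc j)
  from Suc.IH[of "Suc k"] show ?case
    by (simp add: coeff_pderiv algebra_simps)
qed simp

text \<open>The Taylor coefficients of the Jacobi polynomial at \<open>1\<close>, where it is normalised to take the
  value one, are polynomials in the eigenvalue that do not depend on the degree.\<close>

lemma higher_pderiv_jacobi_poly_at_1:
  "poly ((pderiv ^^ j) (jacobi_poly a b n)) 1 = fact j * poly (jacobi_coeff a b j) (jacobi_eigenvalue a b n)"
proof -
  have "(pderiv ^^ j) (jacobi_poly a b n) = pcompose ((pderiv ^^ j) (jacobi_shifted a b n)) [:-1, 1:]"
    by (induction j) (simp_all add: jacobi_poly_def pderiv_shift)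
  then have "poly ((pderiv ^^ j) (jacobi_poly a b n)) 1 = coeff ((pderiv ^^ j) (jacobi_shifted a b n)) 0"
    by (simp add: poly_pcompose poly_0_coeff_0)
  then show ?thesis
    using coeff_higher_pderiv[of 0 j "jacobi_shifted a b n"] by (simp add: coeff_jacobi_shifted)
qed

lemma poly_jacobi_poly_at_1: "poly (jacobi_poly a b n) 1 = 1"
  using higher_pderiv_jacobi_poly_at_1[of 0] by (simp add: jacobi_coeff_def)

lemma jacobi_leading_nonzero:
  assumes "a > -1" "b > -1"
  shows "poly (jacobi_coeff a b n) (jacobi_eigenvalue a b n) \<noteq> 0"
  using jacobi_denominator_nonzero[OF assms(1)] jacobi_eigenvalue_inj[OF assms, of n]
  by (auto simp: jacobi_coeff_def poly_prod)

lemma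
  assumes "a > -1" "b > -1"
  shows degree_jacobi_poly: "degree (jacobi_poly a b n) = n"
    and lead_coeff_jacobi_poly:
      "coeff (jacobi_poly a b n) n = poly (jacobi_coeff a b n) (jacobi_eigenvalue a b n)"
proof -
  have deg: "degree (jacobi_shifted a b n) = n"
  proof (rule antisym)
    show "degree (jacobi_shifted a b n) \<le> n"
      by (rule degree_le) (simp add: coeff_jacobi_shifted poly_jacobi_coeff_eq_0)
    show "n \<le> degree (jacobi_shifted a b n)"
      by (rule le_degree) (simp add: coeff_jacobi_shifted jacobi_leading_nonzero assms)
  qed
  then show d: "degree (jacobi_poly a b n) = n"
    by (simp add: jacobi_poly_def degree_pcompose)
  show "coeff (jacobi_poly a b n) n = poly (jacobi_coeff a b n) (jacobi_eigenvalue a b n)"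
    using lead_coeff_comp[of "[:-1, 1 :: complex:]" "jacobi_shifted a b n"] deg d
    by (simp add: jacobi_poly_def coeff_jacobi_shifted)
qed

lemma jacobi_poly_nonzero: "jacobi_poly a b n \<noteq> 0"
  using poly_jacobi_poly_at_1[of a b n] by force

text \<open>One application of \<open>jacobi_functional_pearson\<close> turns the left-hand side into minus the functional
  at \<open>(1 - x\<^sup>2)\<^sup>2 f' g'\<close>, which is symmetric in \<open>f\<close> and \<open>g\<close>.\<close>

lemma jacobi_functional_symmetric:
  assumes "a > -1" "b > -1"
  shows "jacobi_functional a b ([:1, 0, -1:] * (jacobi_op a b f * g)) =
         jacobi_functional a b ([:1, 0, -1:] * (f * jacobi_op a b g))"
proof -
  have half: "jacobi_functional a b ([:1, 0, -1:] * (jacobi_op a b f * g))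
    + jacobi_functional a b ([:1, 0, -1:] * ([:1, 0, -1:] * (pderiv f * pderiv g))) = 0" for f g
  proof -
    have "lin (b - a) (- (a + b + 4)) = lin (b - a) (- (a + b + 2)) + [:0, -2:]"
      by (simp add: lin_def)
    moreover have "pderiv [:1, 0, -1 :: complex:] = [:0, -2:]"
      by (simp add: pderiv_pCons)
    ultimately have "[:1, 0, -1:] * (jacobi_op a b f * g) + [:1, 0, -1:] * ([:1, 0, -1:] * (pderiv f * pderiv g))
      = pderiv ([:1, 0, -1:] * (pderiv f * g)) * [:1, 0, -1:]
        + ([:1, 0, -1:] * (pderiv f * g)) * lin (b - a) (- (a + b + 2))"
      unfolding jacobi_op_def pderiv_mult by algebra
    then show ?thesis
      using jacobi_functional_pearson[OF assms, of "[:1, 0, -1:] * (pderiv f * g)"]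
      by (simp only: jacobi_functional_add[OF assms, symmetric])
  qed
  have comm: "pderiv g * pderiv f = pderiv f * pderiv g" "jacobi_op a b g * f = f * jacobi_op a b g"
    by (rule mult.commute)+
  show ?thesis
    using half[of f g] half[of g f] unfolding comm by (metis add_right_cancel)
qed

lemma jacobi_poly_orthogonal:
  assumes ab: "a > -1" "b > -1" and "m \<noteq> n"
  shows "jacobi_functional a b ([:1, 0, -1:] * (jacobi_poly a b m * conj_poly (jacobi_poly a b n))) = 0"
proof -
  define p where "p = jacobi_poly a b m"
  define q where "q = jacobi_poly a b n"
  have "conj_poly (jacobi_op a b q) = jacobi_op a b (conj_poly q)"
  proof -
    have "conj_poly [:1, 0, -1:] = [:1, 0, -1:]" "conj_poly (lin c d) = lin c d" for c d
      by (simp_all add: lin_def map_poly_pCons)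
    then show ?thesis
      by (simp only: jacobi_op_def conj_poly_add conj_poly_mult conj_poly_pderiv)
  qed
  moreover have "conj_poly (smult (- jacobi_eigenvalue a b n) q) = smult (- jacobi_eigenvalue a b n) (conj_poly q)"
    by (rule poly_eqI) (simp add: coeff_map_poly jacobi_eigenvalue_def)
  ultimately have q: "jacobi_op a b (conj_poly q) = smult (- jacobi_eigenvalue a b n) (conj_poly q)"
    using jacobi_op_jacobi_poly[OF ab(1), of b n] by (simp add: q_def)
  have p: "jacobi_op a b p = smult (- jacobi_eigenvalue a b m) p"
    using jacobi_op_jacobi_poly[OF ab(1), of b m] by (simp add: p_def)
  have "jacobi_functional a b (smult (- jacobi_eigenvalue a b m) ([:1, 0, -1:] * (p * conj_poly q)))
      = jacobi_functional a b (smult (- jacobi_eigenvalue a b n) ([:1, 0, -1:] * (p * conj_poly q)))"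
    using jacobi_functional_symmetric[OF ab, of p "conj_poly q"]
    unfolding p q by (simp only: mult_smult_left mult_smult_right)
  then have "(jacobi_eigenvalue a b m - jacobi_eigenvalue a b n) *
     jacobi_functional a b ([:1, 0, -1:] * (p * conj_poly q)) = 0"
    unfolding jacobi_functional_smult[OF ab] by (simp add: algebra_simps)
  then show ?thesis
    using jacobi_eigenvalue_inj[OF ab \<open>m \<noteq> n\<close>] by (simp add: p_def q_def)
qed


section \<open>Eigenvalue sequences of differential operators are polynomial\<close>

lemma diff_op_scalar_nth:
  "diff_op Fs (mat q) $ i $ j = (\<Sum>l<length Fs. (pderiv ^^ l) q * (Fs ! l) $ i $ j)"
proof -
  have "(pderiv ^^ l) (0 :: complex poly) = 0" for l by (induction l) simp_all
  then have "((mderiv ^^ l) (mat q) ** F) $ i $ j = (pderiv ^^ l) q * F $ i $ j" for l F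
    using exhaust_2[of i] by (auto simp: matrix_mult_nth2 mderiv_pow_nth mat_def)
  then show ?thesis by (simp add: diff_op_def)
qed

text \<open>At \<open>x = 1\<close> the value of \<open>D\<close> at the \<open>n\<close>-th Jacobi polynomial is a fixed combination of the derivatives
  there, and by \<open>higher_pderiv_jacobi_poly_at_1\<close> these are polynomials in the eigenvalue.\<close>

lemma jacobi_eigenvalues_polynomial:
  assumes "D \<in> diff_ops"
    and "\<And>n. D (mat (jacobi_poly a b n)) = const_mpoly (\<Gamma> n) ** mat (jacobi_poly a b n)"
  shows "\<exists>G :: mpoly. \<forall>n i j. \<Gamma> n $ i $ j = poly (G $ i $ j) (jacobi_eigenvalue a b n)"
proof -
  obtain Fs where D: "D = diff_op Fs" using assms(1) by (auto simp: diff_ops_def)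
  define G :: mpoly where
    "G = (\<chi> i j. \<Sum>l<length Fs. smult (fact l * poly ((Fs ! l) $ i $ j) 1) (jacobi_coeff a b l))"
  have "\<Gamma> n $ i $ j = poly (G $ i $ j) (jacobi_eigenvalue a b n)" for n i j
  proof -
    have "poly ((const_mpoly (\<Gamma> n) ** mat (jacobi_poly a b n)) $ i $ j) 1 = \<Gamma> n $ i $ j"
      using exhaust_2[of j] by (auto simp: matrix_mult_nth2 mat_def poly_jacobi_poly_at_1)
    moreover have "poly (D (mat (jacobi_poly a b n)) $ i $ j) 1 = poly (G $ i $ j) (jacobi_eigenvalue a b n)"
      by (simp add: D diff_op_scalar_nth poly_sum higher_pderiv_jacobi_poly_at_1 G_def algebra_simps)
    ultimately show ?thesis using assms(2) by simp
  qed
  then show ?thesis by blast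
qed

lemma higher_pderiv_monom:
  "(pderiv ^^ l) (monom (1 :: complex) n) = monom (\<Prod>i<l. of_nat n - of_nat i) (n - l)"
proof (induction l)
  case (Suc l)
  have "of_nat (n - l) * (\<Prod>i<l. of_nat n - of_nat i) = (\<Prod>i<Suc l. of_nat n - of_nat i :: complex)"
  proof (cases "l \<le> n")
    case False
    then have "(\<Prod>i<l. of_nat n - of_nat i :: complex) = 0"
      by (intro prod_zero) (auto intro!: bexI[of _ n])
    then show ?thesis by simp
  qed (simp add: of_nat_diff)
  then show ?case by (simp add: Suc.IH pderiv_monom)
qed simp

text \<open>An operator with such eigenvalues does not raise degrees, so the coefficient of \<open>x\<^sup>n\<close> in the
  image of \<open>R n\<close> comes from \<open>x\<^sup>n\<close> alone, where it is a combination of falling factorials of \<open>n\<close>.\<close>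

lemma leading_eigenvalues_polynomial:
  assumes R: "\<And>n. monic_of_degree n (R n)" and "D \<in> diff_ops"
    and eig: "\<And>n. D (R n) = const_mpoly (\<Lambda> n) ** R n"
  shows "\<exists>G :: mpoly. \<forall>n i j. \<Lambda> n $ i $ j = poly (G $ i $ j) (of_nat n)"
proof -
  obtain Fs where D: "D = diff_op Fs" using assms(2) by (auto simp: diff_ops_def)
  have lin: "left_linear D" by (simp add: D left_linear_diff_op)
  define G :: mpoly where
    "G = (\<chi> i j. \<Sum>l<length Fs. smult (coeff ((Fs ! l) $ i $ j) l) (\<Prod>i<l. [:- of_nat i, 1:]))"
  have "\<Lambda> n $ i $ j = poly (G $ i $ j) (of_nat n)" for n i j
  proof -
    have R0: "mcoeff (R m) k = 0" if "m < k" for m k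
      using R[of m] that by (simp add: monic_of_degree_def)
    have R1: "mcoeff (R n) n = mat 1" using R[of n] by (simp add: monic_of_degree_def)
    \<comment> \<open>The terms of lower degree, which do not contribute to the coefficient of \<open>x\<^sup>n\<close>.\<close>
    define Q where "Q = R n - mat (monom 1 n)"
    have "mcoeff Q k = 0" if "k \<ge> n" for k
    proof (cases "k = n")
      case True
      have "mcoeff (mat (monom 1 n)) n = mat 1" by (rule mat2_eqI) (simp_all add: mat_def)
      then show ?thesis using True R1 by (simp add: Q_def mcoeff_diff)
    next
      case False
      then have "mcoeff (mat (monom 1 n)) k = 0" by (intro mat2_eqI) (simp_all add: mat_def)
      then show ?thesis using False that R0[of n k] by (simp add: Q_def mcoeff_diff)
    qed
    then obtain L where "Q = (\<Sum>k<n. const_mpoly (L k) ** R k)"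
      using monic_sequence_expansion[of R n Q, OF R] by blast
    then have "mcoeff (D Q) n = 0"
      by (simp add: left_linear_sum lin left_linear_const mcoeff_sum mcoeff_const_mult eig R0)
    moreover have "D (R n) = D (mat (monom 1 n)) + D Q"
      using left_linear_add[OF lin, of "mat (monom 1 n)" Q] by (simp add: Q_def)
    moreover have top: "mcoeff (D (R n)) n = \<Lambda> n"
      by (simp add: eig mcoeff_const_mult R1)
    ultimately have "\<Lambda> n = mcoeff (D (mat (monom 1 n))) n"
      using top by (simp add: mcoeff_add)
    then have "\<Lambda> n $ i $ j = (\<Sum>l<length Fs. coeff ((pderiv ^^ l) (monom 1 n) * (Fs ! l) $ i $ j) n)"
      by (simp add: D diff_op_scalar_nth coeff_sum)
    also have "\<dots> = (\<Sum>l<length Fs. (\<Prod>i<l. of_nat n - of_nat i) * coeff ((Fs ! l) $ i $ j) l)"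
    proof (rule sum.cong)
      fix l
      have "(\<Prod>i<l. of_nat n - of_nat i :: complex) = 0" if "\<not> l \<le> n"
        using that by (intro prod_zero) (auto intro!: bexI[of _ n])
      then show "coeff ((pderiv ^^ l) (monom 1 n) * (Fs ! l) $ i $ j) n =
          (\<Prod>i<l. of_nat n - of_nat i) * coeff ((Fs ! l) $ i $ j) l"
        by (cases "l \<le> n") (auto simp: higher_pderiv_monom coeff_monom_mult)
    qed simp
    also have "\<dots> = poly (G $ i $ j) (of_nat n)"
      by (simp add: G_def poly_sum poly_prod mult.commute)
    finally show ?thesis .
  qed
  then show ?thesis by blast
qed

section \<open>Monic Jacobi polynomials as scalar matrix polynomials\<close>

lemma mat_nth: "mat p $ i $ j = (if i = j then p else 0)"
  by (simp add: mat_def)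

lemma mat_mult_nth [simp]: "(mat p ** M) $ i $ j = p * M $ i $ j"
  for M :: "'a::comm_ring_1^2^2"
  using exhaust_2[of i] by (auto simp: matrix_mult_nth2 mat_nth)

lemma mult_mat_nth [simp]: "(M ** mat p) $ i $ j = p * M $ i $ j"
  for M :: "'a::comm_ring_1^2^2"
  using exhaust_2[of j] by (auto simp: matrix_mult_nth2 mat_nth)

lemma mat_central: "M ** mat p = mat p ** M"
  for M :: "'a::comm_ring_1^2^2"
  by (simp add: vec_eq_iff)

definition monic_jacobi_poly :: "real \<Rightarrow> real \<Rightarrow> nat \<Rightarrow> complex poly" where
  "monic_jacobi_poly a b n =
     smult (1 / poly (jacobi_coeff a b n) (jacobi_eigenvalue a b n)) (jacobi_poly a b n)"

context
  fixes a b :: real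
  assumes ab: "a > -1" "b > -1"
begin

lemma coeff_monic_jacobi_poly:
  "coeff (monic_jacobi_poly a b n) n = 1" "k > n \<Longrightarrow> coeff (monic_jacobi_poly a b n) k = 0"
  using lead_coeff_jacobi_poly[OF ab, of n] degree_jacobi_poly[OF ab, of n] jacobi_leading_nonzero[OF ab, of n]
  by (simp_all add: monic_jacobi_poly_def coeff_eq_0)

lemma jacobi_op_monic_jacobi_poly:
  "jacobi_op a b (monic_jacobi_poly a b n) = smult (- jacobi_eigenvalue a b n) (monic_jacobi_poly a b n)"
proof -
  have "jacobi_op a b (smult c p) = smult c (jacobi_op a b p)" for c p
    by (simp add: jacobi_op_def pderiv_smult smult_add_right)
  then show ?thesis
    using jacobi_op_jacobi_poly[OF ab(1), of b n] by (simp add: monic_jacobi_poly_def mult.commute)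
qed

lemma monic_jacobi_poly_inner:
  "jacobi_functional a b ([:1, 0, -1:] * (monic_jacobi_poly a b m * conj_poly (monic_jacobi_poly a b n))) = 0
     \<longleftrightarrow> m \<noteq> n"
proof -
  have conj: "conj_poly (smult c p) = smult (cnj c) (conj_poly p)" for c p
    by (rule poly_eqI) (simp add: coeff_map_poly)
  have "[:1, 0, -1:] * (monic_jacobi_poly a b m * conj_poly (monic_jacobi_poly a b n)) =
     smult (1 / poly (jacobi_coeff a b m) (jacobi_eigenvalue a b m) *
       cnj (1 / poly (jacobi_coeff a b n) (jacobi_eigenvalue a b n)))
       ([:1, 0, -1:] * (jacobi_poly a b m * conj_poly (jacobi_poly a b n)))"
    unfolding monic_jacobi_poly_def conj by (simp only: mult_smult_left mult_smult_right smult_smult mult.commute)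
  then show ?thesis
    using jacobi_leading_nonzero[OF ab] jacobi_poly_orthogonal[OF ab, of m n]
      jacobi_functional_norm_nonzero[OF ab jacobi_poly_nonzero, of b n]
      jacobi_functional_norm_nonzero[OF ab jacobi_poly_nonzero, of a b n]
    by (auto simp: jacobi_functional_smult[OF ab])
qed

lemma monic_jacobi_eigenvalues_polynomial:
  assumes D: "D \<in> diff_ops"
    and eig: "\<And>n. D (mat (monic_jacobi_poly a b n)) = const_mpoly (\<Gamma> n) ** mat (monic_jacobi_poly a b n)"
  shows "\<exists>G :: mpoly. \<forall>n i j. \<Gamma> n $ i $ j = poly (G $ i $ j) (jacobi_eigenvalue a b n)"
proof (rule jacobi_eigenvalues_polynomial[OF D])
  fix n
  define c where "c = poly (jacobi_coeff a b n) (jacobi_eigenvalue a b n)"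
  have q: "mat (jacobi_poly a b n) = const_mpoly (mat c) ** mat (monic_jacobi_poly a b n)"
    using jacobi_leading_nonzero[OF ab, of n]
    by (intro mat2_eqI) (simp_all add: c_def mat_nth monic_jacobi_poly_def)
  have "const_mpoly (mat c) ** const_mpoly (\<Gamma> n) = const_mpoly (\<Gamma> n) ** const_mpoly (mat c)"
    unfolding const_mpoly_mult[symmetric] mat_central ..
  then show "D (mat (jacobi_poly a b n)) = const_mpoly (\<Gamma> n) ** mat (jacobi_poly a b n)"
    unfolding q left_linear_const[OF left_linear_diff_ops[OF D]] eig
    by (simp add: matrix_mul_assoc)
qed

end


section \<open>Uniqueness of the monic orthogonal sequence\<close>

definition sesquilinear :: "(mpoly \<Rightarrow> mpoly \<Rightarrow> cmat) \<Rightarrow> bool" where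
  "sesquilinear ip \<longleftrightarrow>
     (\<forall>P Q R. ip P (Q + R) = ip P Q + ip P R) \<and>
     (\<forall>A P Q. ip (const_mpoly A ** P) Q = A ** ip P Q) \<and>
     (\<forall>A P Q. ip P (const_mpoly A ** Q) = ip P Q ** ctranspose A)"

text \<open>Positivity is replaced by nondegeneracy of the norms of one orthogonal sequence: the difference
  to a second such sequence is a combination of lower members of the first, and pairing with each
  of them shows that its coefficients vanish.\<close>

lemma monic_OP_eqI:
  assumes R: "monic_orthogonal_seq W R"
    and ses: "sesquilinear (weight_inner W)"
    and nondeg: "\<And>n L. weight_inner W (R n) (R n) ** ctranspose L = 0 \<Longrightarrow> L = 0"
  shows "monic_OP W = R"
  unfolding monic_OP_def
proof (rule the_equality[where P = "monic_orthogonal_seq W", OF R])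
  fix S assume S: "monic_orthogonal_seq W S"
  have monic: "monic_of_degree n (R n)" "monic_of_degree n (S n)" for n
    using R S by (simp_all add: monic_orthogonal_seq_def)
  have add: "weight_inner W P (Q + Q') = weight_inner W P Q + weight_inner W P Q'"
    and const: "weight_inner W P (const_mpoly A ** Q) = weight_inner W P Q ** ctranspose A" for P Q Q' A
    using ses by (simp_all add: sesquilinear_def)
  have zero: "weight_inner W P 0 = 0" for P
    using add[of P 0 0] by simp
  have sum: "weight_inner W P (\<Sum>i\<in>I. f i) = (\<Sum>i\<in>I. weight_inner W P (f i))" for P f and I :: "nat set"
    by (induction I rule: infinite_finite_induct) (simp_all add: zero add)
  have "S n = R n" for n
  proof (induction n rule: less_induct)
    case (less n)
    have "mcoeff (S n - R n) k = 0" if "k \<ge> n" for k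
      using that monic[of n] by (cases "k = n") (simp_all add: monic_of_degree_def mcoeff_diff)
    then obtain L where L: "S n - R n = (\<Sum>k<n. const_mpoly (L k) ** R k)"
      using monic_sequence_expansion[of R n "S n - R n", OF monic(1)] by blast
    have "L m = 0" if "m < n" for m
    proof (rule nondeg)
      have "weight_inner W (R m) (R k) = 0" if "k \<noteq> m" for k
        using R that by (simp add: monic_orthogonal_seq_def)
      then have "weight_inner W (R m) (S n - R n) = (\<Sum>k<n. if k = m then weight_inner W (R m) (R k) ** ctranspose (L k) else 0)"
        unfolding L sum const by (intro sum.cong) auto
      also have "\<dots> = weight_inner W (R m) (R m) ** ctranspose (L m)"
        using that by (simp add: sum.delta)
      finally have eq: "weight_inner W (R m) (S n - R n) = weight_inner W (R m) (R m) ** ctranspose (L m)" .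
      have "weight_inner W (S m) (S n) = 0" and Rmn: "weight_inner W (R m) (R n) = 0"
        using R S that by (simp_all add: monic_orthogonal_seq_def)
      then have "weight_inner W (R m) (S n) = 0"
        using less.IH[OF that] by simp
      then show "weight_inner W (R m) (R m) ** ctranspose (L m) = 0"
        using add[of "R m" "S n - R n" "R n"] eq Rmn by simp
    qed
    then have "S n - R n = 0" unfolding L by (intro sum.neutral) simp
    then show ?case by simp
  qed
  then show "S = R" by blast
qed

lemma sesquilinear_functional:
  assumes "a > -1" "b > -1"
  shows "sesquilinear (\<lambda>P Q. matrix_functional (jacobi_functional a b) (P ** M ** adj_mpoly Q))"
proof -
  let ?J = "matrix_functional (jacobi_functional a b)"
  have add: "?J (P + Q) = ?J P + ?J Q" for P Q
    by (simp add: vec_eq_iff jacobi_functional_add[OF assms])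
  have scale: "jacobi_functional a b ([:c:] * p) = c * jacobi_functional a b p"
    "jacobi_functional a b (p * [:c:]) = c * jacobi_functional a b p" for c p
    by (simp_all add: jacobi_functional_smult[OF assms])
  have left: "?J (const_mpoly A ** P) = A ** ?J P" for A P
    by (rule mat2_eqI) (simp_all only: matrix_mult_nth2 matrix_functional_nth const_mpoly_nth
        jacobi_functional_add[OF assms] scale)
  have right: "?J (P ** const_mpoly A) = ?J P ** A" for A P
    by (rule mat2_eqI) (simp_all only: matrix_mult_nth2 matrix_functional_nth const_mpoly_nth
        jacobi_functional_add[OF assms] scale mult.commute)
  show ?thesis
    unfolding sesquilinear_def adj_mpoly_add adj_mpoly_mult adj_mpoly_const matrix_add_ldistrib add
    by (simp add: left right flip: matrix_mul_assoc)
       (simp add: right matrix_mul_assoc)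
qed


section \<open>The first-order factors and the orthogonal polynomials of the weight\<close>

locale jacobi_parameters =
  fixes \<alpha> \<beta> v :: real
  assumes diff_less: "\<bar>\<alpha> - \<beta>\<bar> < \<bar>v\<bar>" and less_sum: "\<bar>v\<bar> < \<alpha> + \<beta> + 2"
begin

lemma exponents: "\<alpha> > -1" "\<beta> > -1"
  using diff_less less_sum by linarith+

lemma v_nonzero: "v \<noteq> 0"
  using diff_less by auto

definition k :: real where "k = (\<beta> - \<alpha>) / v"

definition s :: real where "s = \<alpha> + \<beta>"

lemma k_bound: "\<bar>k\<bar> < 1"
  using diff_less by (simp add: k_def divide_less_eq abs_minus_commute)

definition w1 :: real where "w1 = v * (v + 2 + \<alpha> + \<beta>) / (v + \<alpha> - \<beta>)"
definition w2 :: real where "w2 = v * (- v + 2 + \<alpha> + \<beta>) / (v - \<alpha> + \<beta>)"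

lemma w_nonzero: "w1 \<noteq> 0" "w2 \<noteq> 0"
  using diff_less less_sum by (auto simp: w1_def w2_def)

lemma parameter_relations:
  "complex_of_real k * of_real v = of_real \<beta> - of_real \<alpha>"
  "complex_of_real w1 * (1 - of_real k) = of_real v + 2 + of_real \<alpha> + of_real \<beta>"
  "complex_of_real w2 * (1 + of_real k) = - of_real v + 2 + of_real \<alpha> + of_real \<beta>"
proof -
  have kv: "k * v = \<beta> - \<alpha>"
    using v_nonzero by (simp add: k_def)
  then have "v + \<alpha> - \<beta> = v * (1 - k)" "v - \<alpha> + \<beta> = v * (1 + k)"
    by (simp_all add: algebra_simps)
  moreover have "1 - k \<noteq> 0" "1 + k \<noteq> 0" using k_bound by auto
  ultimately have "k * v = \<beta> - \<alpha>" "w1 * (1 - k) = v + 2 + \<alpha> + \<beta>" "w2 * (1 + k) = - v + 2 + \<alpha> + \<beta>"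
    using v_nonzero kv by (simp_all add: w1_def w2_def)
  then have "complex_of_real (k * v) = of_real (\<beta> - \<alpha>)"
    "complex_of_real (w1 * (1 - k)) = of_real (v + 2 + \<alpha> + \<beta>)"
    "complex_of_real (w2 * (1 + k)) = of_real (- v + 2 + \<alpha> + \<beta>)" by simp_all
  then show "complex_of_real k * of_real v = of_real \<beta> - of_real \<alpha>"
    "complex_of_real w1 * (1 - of_real k) = of_real v + 2 + of_real \<alpha> + of_real \<beta>"
    "complex_of_real w2 * (1 + of_real k) = - of_real v + 2 + of_real \<alpha> + of_real \<beta>"
    by simp_all
qed

text \<open>All three parameters are polynomials in \<open>k\<close>, \<open>w1\<close> and \<open>w2\<close>. After this substitution the
  identities below hold coefficient by coefficient, without any side relation.\<close>

lemma parameter_elimination: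
  "complex_of_real v = (of_real w1 * (1 - of_real k) - of_real w2 * (1 + of_real k)) / 2"
  "complex_of_real \<alpha> = (of_real w1 * (1 - of_real k) - 2 -
     (1 + of_real k) * (of_real w1 * (1 - of_real k) - of_real w2 * (1 + of_real k)) / 2) / 2"
  "complex_of_real \<beta> = (of_real w1 * (1 - of_real k) - 2 -
     (1 - of_real k) * (of_real w1 * (1 - of_real k) - of_real w2 * (1 + of_real k)) / 2) / 2"
proof -
  have v2: "2 * complex_of_real v = of_real w1 * (1 - of_real k) - of_real w2 * (1 + of_real k)"
    unfolding parameter_relations by simp
  then show v: "complex_of_real v = (of_real w1 * (1 - of_real k) - of_real w2 * (1 + of_real k)) / 2"
    by (simp add: mult.commute)
  have b: "complex_of_real \<beta> = of_real \<alpha> + of_real k * of_real v"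
    using parameter_relations(1) by simp
  show "complex_of_real \<alpha> = (of_real w1 * (1 - of_real k) - 2 -
     (1 + of_real k) * (of_real w1 * (1 - of_real k) - of_real w2 * (1 + of_real k)) / 2) / 2"
    "complex_of_real \<beta> = (of_real w1 * (1 - of_real k) - 2 -
     (1 - of_real k) * (of_real w1 * (1 - of_real k) - of_real w2 * (1 + of_real k)) / 2) / 2"
    unfolding v2[symmetric] unfolding parameter_relations(2)
    by (simp_all add: b field_simps)
qed

definition V0 :: cmat where "V0 = rmat2 ((v + 2 + \<alpha> + \<beta>) / 2) 0 0 ((- v + 2 + \<alpha> + \<beta>) / 2)"
definition V1 :: mpoly where "V1 = mat2 (lin k 1) (lin (1 + k) 0) (lin (1 - k) 0) (lin (- k) 1)"
definition N0 :: cmat where "N0 = rmat2 (- (1 / 2) * (- v + 4 + \<alpha> + \<beta>)) 0 0 (- (1 / 2) * (\<alpha> + \<beta> + v + 4))"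
definition N1 :: mpoly where "N1 = mat2 (lin k (-1)) (lin (1 + k) 0) (lin (1 - k) 0) (lin (- k) (-1))"
definition weight_poly :: mpoly where
  "weight_poly = mat [:1/4, -1/2, 1/4:] ** const_mpoly (rmat2 w1 0 0 w2) +
     mat [:1/2, -1/2:] ** const_mpoly (jacobi_W1 \<alpha> \<beta> v) + const_mpoly (jacobi_W0 \<alpha>)"
definition C :: cmat where "C = rmat2 (- w1 / 4) 0 0 (- w2 / 4)"

text \<open>By \<open>V1_weight\<close> this is the quotient of \<open>V1 ** weight_poly\<close> by \<open>1 - x\<^sup>2\<close>.\<close>

definition T :: mpoly where "T = - (const_mpoly C ** adj_mpoly N1)"

lemma minus_k: "(\<alpha> - \<beta>) / v = - k"
  by (simp add: k_def minus_divide_left)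

lemma op_V_apply: "op_V \<alpha> \<beta> v P = P ** const_mpoly V0 + mderiv P ** V1"
  unfolding op_V_def minus_k k_def[symmetric] by (simp add: first_order_apply V0_def V1_def)

lemma op_N_apply: "op_N \<alpha> \<beta> v P = P ** const_mpoly N0 + mderiv P ** N1"
  unfolding op_N_def minus_k k_def[symmetric] by (simp add: first_order_apply N0_def N1_def)

lemma jacobi_weight_eq:
  "jacobi_weight \<alpha> \<beta> v x = ((1 - x) powr \<alpha> * (1 + x) powr \<beta>) *\<^sub>R meval weight_poly x"
  unfolding jacobi_weight_def jacobi_W2_def w1_def[symmetric] w2_def[symmetric]
  by (intro arg_cong[where f = "\<lambda>M. ((1 - x) powr \<alpha> * (1 + x) powr \<beta>) *\<^sub>R M"] mat2_eqI)
    (simp_all add: weight_poly_def rmat2_def power2_eq_square, simp_all add: scaleR_conv_of_real field_simps)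

text \<open>The leading coefficient of \<open>op_V\<close> turns the weight polynomial into a multiple of \<open>1 - x\<^sup>2\<close>. This
  raises both exponents by one and so removes the boundary terms in the integration by parts.\<close>

lemma V1_weight: "V1 ** weight_poly = mat [:1, 0, -1:] ** T"
  by (intro mat2_eqI)
    (simp_all add: matrix_mult_nth2 T_def V1_def N1_def weight_poly_def jacobi_W1_def jacobi_W0_def
      C_def rmat2_def lin_def map_poly_pCons mat_nth,
     simp_all add: parameter_elimination field_simps)

text \<open>Together with \<open>V1_weight\<close> this is the statement that \<open>op_V\<close> and \<open>op_N\<close> are adjoint, at the level
  of coefficients.\<close>

lemma V0_weight:
  "const_mpoly V0 ** weight_poly = mat [:1, 0, -1:] ** mderiv T + mat (lin (\<beta> - \<alpha>) (- (\<alpha> + \<beta> + 2))) ** T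
     + mat [:1, 0, -1:] ** (const_mpoly C ** adj_mpoly (const_mpoly N0))"
  by (intro mat2_eqI)
    (simp_all add: matrix_mult_nth2 T_def V0_def N0_def N1_def weight_poly_def jacobi_W1_def jacobi_W0_def
      C_def rmat2_def lin_def map_poly_pCons pderiv_pCons mat_nth,
     simp_all add: parameter_elimination field_simps)

lemma V1_N1: "V1 ** N1 = mat [:1, 0, -1:]"
  by (rule mat2_eqI) (simp_all add: matrix_mult_nth2 V1_def N1_def lin_def mat_nth algebra_simps)

lemma first_order_coefficient:
  "mderiv V1 ** N1 + const_mpoly V0 ** N1 + V1 ** const_mpoly N0 = mat (lin (\<beta> - \<alpha>) (- (\<alpha> + \<beta> + 4)))"
  by (intro mat2_eqI)
    (simp_all add: matrix_mult_nth2 V1_def V0_def N0_def N1_def rmat2_def lin_def pderiv_pCons mat_nth,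
     simp_all add: parameter_elimination field_simps)

text \<open>Integration by parts: up to the constant matrix \<open>C\<close>, the operator \<open>op_N\<close> is the adjoint of
  \<open>op_V\<close>, with the scalar weight \<open>(1 - x)\<^sup>\<alpha>\<^sup>+\<^sup>1 (1 + x)\<^sup>\<beta>\<^sup>+\<^sup>1\<close> on the right-hand side. Its additional factor
  \<open>1 - x\<^sup>2\<close> appears as a polynomial because the functional carries the exponents \<open>\<alpha>\<close> and \<open>\<beta>\<close>.\<close>

lemma weight_inner_op_V:
  "weight_inner (jacobi_weight \<alpha> \<beta> v) (op_V \<alpha> \<beta> v P) Q =
   matrix_functional (jacobi_functional \<alpha> \<beta>)
     (mat [:1, 0, -1:] ** P ** const_mpoly C ** adj_mpoly (op_N \<alpha> \<beta> v Q))"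
proof -
  let ?J = "matrix_functional (jacobi_functional \<alpha> \<beta>)"
  let ?X = "mat [:1, 0, -1:] :: mpoly"
  let ?r = "mat (lin (\<beta> - \<alpha>) (- (\<alpha> + \<beta> + 2))) :: mpoly"
  define S where "S = adj_mpoly Q"
  \<comment> \<open>\<open>G\<close> is the matrix whose derivative, multiplied by the scalar weight, integrates to zero; \<open>H\<close> is the
    part of that derivative in which \<open>Q\<close> is differentiated.\<close>
  define G where "G = P ** T ** S"
  define K where "K = ?X ** (P ** const_mpoly C ** adj_mpoly (const_mpoly N0) ** S)"
  define H where "H = ?X ** (P ** T ** mderiv S)"
  have add: "?J (F + G) = ?J F + ?J G" for F G
    by (simp add: vec_eq_iff jacobi_functional_add[OF exponents])
  have zero: "?J (?X ** mderiv G + ?r ** G) = 0"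
    using jacobi_functional_pearson[OF exponents] by (simp add: vec_eq_iff mult.commute)
  have pull: "F ** (mat g ** M) ** S = mat g ** (F ** M ** S)" for g and F M :: mpoly
    by (simp add: matrix_mul_assoc mat_central[of F])
  have "op_V \<alpha> \<beta> v P ** weight_poly ** S =
      P ** (const_mpoly V0 ** weight_poly) ** S + mderiv P ** (V1 ** weight_poly) ** S"
    by (simp add: op_V_apply matrix_add_rdistrib' matrix_mul_assoc)
  also have "\<dots> = P ** (?X ** mderiv T) ** S + P ** (?r ** T) ** S
      + P ** (?X ** (const_mpoly C ** adj_mpoly (const_mpoly N0))) ** S + mderiv P ** (?X ** T) ** S"
    unfolding V0_weight V1_weight by (simp add: matrix_add_ldistrib matrix_add_rdistrib')
  also have "\<dots> = ?X ** (P ** mderiv T ** S) + ?r ** (P ** T ** S) + K + ?X ** (mderiv P ** T ** S)"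
    unfolding pull K_def by (simp only: matrix_mul_assoc)
  also have "\<dots> + H = (?X ** mderiv G + ?r ** G) + K"
    by (simp add: G_def H_def mderiv_mult matrix_add_ldistrib matrix_add_rdistrib' algebra_simps)
  finally have "?J (op_V \<alpha> \<beta> v P ** weight_poly ** S) + ?J H = ?J K"
    unfolding add[symmetric] by (simp only: add zero[unfolded add] add_0_left)
  moreover have "K = H + ?X ** P ** const_mpoly C ** adj_mpoly (op_N \<alpha> \<beta> v Q)"
  proof -
    have "adj_mpoly (op_N \<alpha> \<beta> v Q) = adj_mpoly (const_mpoly N0) ** S + adj_mpoly N1 ** mderiv S"
      by (simp add: op_N_apply S_def adj_mpoly_add adj_mpoly_mult adj_mpoly_mderiv)
    moreover have "H = - (?X ** P ** const_mpoly C ** (adj_mpoly N1 ** mderiv S))"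
    proof -
      have "F ** (- M) = - (F ** M)" "(- F) ** M = - (F ** M)" for F M :: mpoly
        by (rule mat2_eqI; simp add: matrix_mult_nth2)+
      then show ?thesis by (simp add: H_def T_def matrix_mul_assoc)
    qed
    ultimately show ?thesis
      by (simp add: K_def matrix_add_ldistrib matrix_mul_assoc)
  qed
  ultimately show ?thesis
    unfolding weight_inner_eq_functional[OF exponents jacobi_weight_eq] S_def by (simp add: add)
qed

text \<open>The diagonal matrices \<open>B\<^sub>n\<close> and \<open>A\<^sub>n\<close> with \<open>p\<^sub>n \<cdot> V = B\<^sub>n P\<^sub>n\<close> and \<open>P\<^sub>n \<cdot> N = A\<^sub>n p\<^sub>n\<close>, read off from
  leading coefficients.\<close>

definition eigen_B :: "nat \<Rightarrow> cmat" where
  "eigen_B n = mat2 (of_nat n + of_real ((2 + s + v) / 2)) 0 0 (of_nat n + of_real ((2 + s - v) / 2))"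

definition eigen_A :: "nat \<Rightarrow> cmat" where
  "eigen_A n = mat2 (- (of_nat n + of_real ((4 + s - v) / 2))) 0 0 (- (of_nat n + of_real ((4 + s + v) / 2)))"

lemma eigen_nonzero:
  "eigen_B n $ 1 $ 1 \<noteq> 0" "eigen_B n $ 2 $ 2 \<noteq> 0" "eigen_A n $ 1 $ 1 \<noteq> 0" "eigen_A n $ 2 $ 2 \<noteq> 0"
proof -
  have pos: "real n + r \<noteq> 0 \<Longrightarrow> complex_of_nat n + of_real r \<noteq> 0" for r
    using of_real_eq_0_iff[of "real n + r", where ?'a = complex] by simp
  have "real n + (2 + s + v) / 2 > 0" "real n + (2 + s - v) / 2 > 0"
    "real n + (4 + s - v) / 2 > 0" "real n + (4 + s + v) / 2 > 0"
    using less_sum by (simp_all add: s_def add_nonneg_pos)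
  then have "real n + (2 + s + v) / 2 \<noteq> 0" "real n + (2 + s - v) / 2 \<noteq> 0"
    "real n + (4 + s - v) / 2 \<noteq> 0" "real n + (4 + s + v) / 2 \<noteq> 0" by simp_all
  from this[THEN pos] show "eigen_B n $ 1 $ 1 \<noteq> 0" "eigen_B n $ 2 $ 2 \<noteq> 0" "eigen_A n $ 1 $ 1 \<noteq> 0" "eigen_A n $ 2 $ 2 \<noteq> 0"
    by (simp_all only: eigen_A_def eigen_B_def mat2_nth neg_equal_0_iff_equal not_False_eq_True)
qed

definition eigen_B_inv :: "nat \<Rightarrow> cmat" where
  "eigen_B_inv n = mat2 (1 / eigen_B n $ 1 $ 1) 0 0 (1 / eigen_B n $ 2 $ 2)"

lemma eigen_B_inverse: "eigen_B_inv n ** eigen_B n = mat 1" "eigen_B n ** eigen_B_inv n = mat 1"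
  using eigen_nonzero(1,2)[of n]
  by (auto intro!: mat2_eqI simp: matrix_mult_nth2 eigen_B_inv_def mat_nth eigen_B_def)

lemma eigen_B_cancel: "eigen_B n ** Y = eigen_B n ** Z \<Longrightarrow> Y = Z"
  by (metis eigen_B_inverse(1) matrix_mul_assoc matrix_mul_lid)

abbreviation scalar_OP :: "nat \<Rightarrow> mpoly" where "scalar_OP n \<equiv> mat (monic_jacobi_poly \<alpha> \<beta> n)"

definition matrix_OP :: "nat \<Rightarrow> mpoly" where
  "matrix_OP n = const_mpoly (eigen_B_inv n) ** op_V \<alpha> \<beta> v (scalar_OP n)"

lemma op_V_scalar_OP: "op_V \<alpha> \<beta> v (scalar_OP n) = const_mpoly (eigen_B n) ** matrix_OP n"
  by (simp add: matrix_OP_def matrix_mul_assoc eigen_B_inverse flip: const_mpoly_mult)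

lemma op_linear: "left_linear (op_V \<alpha> \<beta> v)" "left_linear (op_N \<alpha> \<beta> v)"
  by (simp_all add: op_V_def op_N_def left_linear_diff_op)

text \<open>The coefficients of the first and second derivatives are scalar, so \<open>op_V\<close> followed by \<open>op_N\<close>
  is the Jacobi operator in every entry, up to multiplication by a constant diagonal matrix.\<close>

lemma op_N_op_V: "op_N \<alpha> \<beta> v (op_V \<alpha> \<beta> v P) =
  P ** const_mpoly (V0 ** N0) + mderiv P ** mat (lin (\<beta> - \<alpha>) (- (\<alpha> + \<beta> + 4))) +
  mderiv (mderiv P) ** mat [:1, 0, -1:]"
  unfolding V1_N1[symmetric] first_order_coefficient[symmetric] op_N_apply op_V_apply mderiv_add mderiv_mult
    mderiv_const const_mpoly_mult
  by (simp add: matrix_add_ldistrib matrix_add_rdistrib' matrix_mul_assoc algebra_simps)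

lemma eigen_B_A:
  "eigen_B n ** eigen_A n = V0 ** N0 - mat (jacobi_eigenvalue \<alpha> \<beta> n)"
  by (rule mat2_eqI)
    (simp_all add: matrix_mult_nth2 eigen_B_def eigen_A_def V0_def N0_def rmat2_def s_def
      jacobi_eigenvalue_def mat_nth field_simps)

text \<open>Since \<open>op_V\<close> followed by \<open>op_N\<close> multiplies the scalar polynomial by \<open>B\<^sub>n A\<^sub>n\<close>, cancelling \<open>B\<^sub>n\<close> leaves
  \<open>A\<^sub>n\<close>.\<close>

lemma op_N_matrix_OP: "op_N \<alpha> \<beta> v (matrix_OP n) = const_mpoly (eigen_A n) ** scalar_OP n"
proof -
  have "op_N \<alpha> \<beta> v (op_V \<alpha> \<beta> v (scalar_OP n)) = const_mpoly (eigen_B n ** eigen_A n) ** scalar_OP n"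
  proof -
    define q where "q = monic_jacobi_poly \<alpha> \<beta> n"
    have mderiv_mat: "mderiv (mat r) = mat (pderiv r)" for r
      by (rule mat2_eqI) (simp_all add: mat_nth)
    have "lin (\<beta> - \<alpha>) (- (\<alpha> + \<beta> + 4)) * pderiv q + [:1, 0, -1:] * pderiv (pderiv q) = 
        smult (- jacobi_eigenvalue \<alpha> \<beta> n) q"
      using jacobi_op_monic_jacobi_poly[OF exponents, of n] by (simp add: jacobi_op_def q_def add.commute)
    then have "mderiv (mat q) ** mat (lin (\<beta> - \<alpha>) (- (\<alpha> + \<beta> + 4))) + mderiv (mderiv (mat q)) ** mat [:1, 0, -1:]
       = mat (smult (- jacobi_eigenvalue \<alpha> \<beta> n) q)"
      unfolding mderiv_mat by (intro mat2_eqI) (simp_all only: vector_add_component mult_mat_nth mat_nth, simp_all)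
    then have "op_N \<alpha> \<beta> v (op_V \<alpha> \<beta> v (mat q)) =
        mat q ** const_mpoly (V0 ** N0) + mat (smult (- jacobi_eigenvalue \<alpha> \<beta> n) q)"
      unfolding op_N_op_V by (simp only: add.assoc)
    also have "\<dots> = const_mpoly (eigen_B n ** eigen_A n) ** mat q"
      unfolding eigen_B_A by (rule mat2_eqI) (simp_all add: mat_nth smult_diff_left)
    finally show ?thesis by (simp add: q_def)
  qed
  then have "op_N \<alpha> \<beta> v (matrix_OP n) = const_mpoly (eigen_B_inv n) ** (const_mpoly (eigen_B n ** eigen_A n) ** scalar_OP n)"
    by (simp add: matrix_OP_def left_linear_const op_linear)
  then show ?thesis
    by (simp add: matrix_mul_assoc eigen_B_inverse flip: const_mpoly_mult)
qed

lemma matrix_OP_monic: "monic_of_degree n (matrix_OP n)"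
proof -
  have coeff: "mcoeff (op_V \<alpha> \<beta> v (scalar_OP n)) k = (if k = n then eigen_B n else 0)" if "k \<ge> n" for k
  proof -
    have "coeff (pderiv (monic_jacobi_poly \<alpha> \<beta> n)) k = 0"
      using that coeff_monic_jacobi_poly(2)[OF exponents, of n "Suc k"] by (simp add: coeff_pderiv)
    moreover have "coeff (pCons 0 (pderiv (monic_jacobi_poly \<alpha> \<beta> n))) k = of_nat k * coeff (monic_jacobi_poly \<alpha> \<beta> n) k"
      by (cases k) (simp_all add: coeff_pderiv)
    moreover have "coeff (monic_jacobi_poly \<alpha> \<beta> n) k = (if k = n then 1 else 0)"
      using that coeff_monic_jacobi_poly[OF exponents] by auto
    ultimately show ?thesis
      by (intro mat2_eqI)
        (auto simp: op_V_apply matrix_mult_nth2 mat_nth V0_def V1_def rmat2_def lin_def eigen_B_def s_def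
          field_simps)
  qed
  show ?thesis
    unfolding monic_of_degree_def matrix_OP_def mcoeff_const_mult
    by (auto simp: coeff eigen_B_inverse)
qed

text \<open>The adjoint relation moves \<open>op_V\<close> to the second argument, where \<open>op_N\<close> produces scalar Jacobi
  polynomials again. Orthogonality and nondegeneracy for the matrix weight are thereby inherited from
  the scalar weight.\<close>

lemma matrix_OP_inner: "eigen_B m ** weight_inner (jacobi_weight \<alpha> \<beta> v) (matrix_OP m) (matrix_OP n) =
  mat (jacobi_functional \<alpha> \<beta> ([:1, 0, -1:] * (monic_jacobi_poly \<alpha> \<beta> m * conj_poly (monic_jacobi_poly \<alpha> \<beta> n))))
   ** (C ** ctranspose (eigen_A n))"
proof -
  let ?q = "monic_jacobi_poly \<alpha> \<beta>"
  have adj: "adj_mpoly (op_N \<alpha> \<beta> v (matrix_OP n)) = mat (conj_poly (?q n)) ** const_mpoly (ctranspose (eigen_A n))"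
    unfolding op_N_matrix_OP adj_mpoly_mult adj_mpoly_const
    by (rule arg_cong2[where f = "(**)"]) (auto intro!: mat2_eqI simp: mat_nth)
  have "mat [:1, 0, -1:] ** scalar_OP m ** const_mpoly C ** adj_mpoly (op_N \<alpha> \<beta> v (matrix_OP n)) =
      mat ([:1, 0, -1:] * (?q m * conj_poly (?q n))) ** const_mpoly (C ** ctranspose (eigen_A n))"
  proof -
    have "mat f ** mat g ** M ** (mat h ** N) = mat (f * (g * h)) ** (M ** N)" for f g h :: "complex poly" and M N :: mpoly
      by (rule mat2_eqI) (simp_all add: matrix_mult_nth2 mat_nth algebra_simps)
    then show ?thesis by (simp only: adj const_mpoly_mult)
  qed
  moreover have "eigen_B m ** weight_inner (jacobi_weight \<alpha> \<beta> v) (matrix_OP m) (matrix_OP n) =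
      weight_inner (jacobi_weight \<alpha> \<beta> v) (op_V \<alpha> \<beta> v (scalar_OP m)) (matrix_OP n)"
    using sesquilinear_functional[OF exponents, of weight_poly]
    unfolding op_V_scalar_OP weight_inner_eq_functional[OF exponents jacobi_weight_eq] sesquilinear_def by simp
  ultimately have "eigen_B m ** weight_inner (jacobi_weight \<alpha> \<beta> v) (matrix_OP m) (matrix_OP n) =
     matrix_functional (jacobi_functional \<alpha> \<beta>)
       (mat ([:1, 0, -1:] * (?q m * conj_poly (?q n))) ** const_mpoly (C ** ctranspose (eigen_A n)))"
    by (simp only: weight_inner_op_V)
  also have "\<dots> = mat (jacobi_functional \<alpha> \<beta> ([:1, 0, -1:] * (?q m * conj_poly (?q n)))) ** (C ** ctranspose (eigen_A n))"
  proof -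
    have "jacobi_functional \<alpha> \<beta> (f * [:c:]) = jacobi_functional \<alpha> \<beta> f * c" for f c
      using jacobi_functional_smult[OF exponents, of c f] by (simp add: mult.commute)
    then show ?thesis
      by (intro mat2_eqI) (simp_all only: mat_mult_nth matrix_functional_nth const_mpoly_nth)
  qed
  finally show ?thesis .
qed

lemma monic_OP_eq: "monic_OP (jacobi_weight \<alpha> \<beta> v) = matrix_OP"
proof (rule monic_OP_eqI)
  let ?ip = "weight_inner (jacobi_weight \<alpha> \<beta> v)"
  show "monic_orthogonal_seq (jacobi_weight \<alpha> \<beta> v) matrix_OP"
    unfolding monic_orthogonal_seq_def
  proof (intro conjI allI impI matrix_OP_monic)
    fix m n :: nat assume "m \<noteq> n"
    then have "eigen_B m ** ?ip (matrix_OP m) (matrix_OP n) = eigen_B m ** 0"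
      unfolding matrix_OP_inner using monic_jacobi_poly_inner[OF exponents, of m n]
      by (simp add: vec_eq_iff)
    then show "?ip (matrix_OP m) (matrix_OP n) = 0" by (rule eigen_B_cancel)
  qed
  show "sesquilinear ?ip"
    using sesquilinear_functional[OF exponents, of weight_poly]
    by (simp add: weight_inner_eq_functional[OF exponents jacobi_weight_eq, abs_def])
  fix n L
  assume L: "?ip (matrix_OP n) (matrix_OP n) ** ctranspose L = 0"
  define h where "h = jacobi_functional \<alpha> \<beta> ([:1, 0, -1:] * (monic_jacobi_poly \<alpha> \<beta> n * conj_poly (monic_jacobi_poly \<alpha> \<beta> n)))"
  have "h \<noteq> 0" using monic_jacobi_poly_inner[OF exponents, of n n] by (simp add: h_def)
  moreover have "mat h ** (C ** ctranspose (eigen_A n)) ** ctranspose L = 0"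
    using L unfolding h_def matrix_OP_inner[symmetric] by (simp flip: matrix_mul_assoc)
  ultimately have "(C ** (ctranspose (eigen_A n) ** ctranspose L)) $ i $ j = 0" for i j
    using mat_mult_nth[of h "C ** (ctranspose (eigen_A n) ** ctranspose L)" i j] by (simp add: matrix_mul_assoc)
  from this[of 1 1] this[of 1 2] this[of 2 1] this[of 2 2] show "L = 0"
    using w_nonzero eigen_nonzero(3,4)[of n]
    by (intro mat2_eqI) (simp_all add: matrix_mult_nth2 C_def rmat2_def ctranspose_def eigen_A_def)
qed

end

section \<open>Symbols of differential operators\<close>

lemma higher_pderiv_power_mult:
  fixes f :: "complex poly"
  assumes "j \<le> n"
  shows "\<exists>g. (pderiv ^^ j) ([:- y, 1:] ^ n * f) = [:- y, 1:] ^ (n - j) * g \<and>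
             fact (n - j) * poly g y = fact n * poly f y"
  using assms
proof (induction j)
  case (Suc j)
  define m where "m = n - Suc j"
  have m: "n - j = Suc m" using Suc.prems by (simp add: m_def)
  from Suc obtain g where g: "(pderiv ^^ j) ([:- y, 1:] ^ n * f) = [:- y, 1:] ^ Suc m * g"
    "fact (Suc m) * poly g y = fact n * poly f y"
    unfolding m[symmetric] by auto
  define h where "h = smult (of_nat (Suc m)) g + [:- y, 1:] * pderiv g"
  have "pderiv ([:- y, 1:] ^ Suc m * g) = [:- y, 1:] ^ m * h"
    unfolding h_def pderiv_mult pderiv_power_Suc by (simp add: pderiv_pCons algebra_simps)
  moreover have "fact m * poly h y = fact n * poly f y"
    using g(2) by (simp add: h_def algebra_simps)
  ultimately show ?case using g(1) by (auto simp: m_def[symmetric])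
qed auto

text \<open>Test functions vanishing to order \<open>n\<close> at \<open>y\<close> isolate the coefficient of order \<open>n\<close>.\<close>

lemma diff_op_leading_coefficient:
  assumes "length Fs = Suc n"
  shows "poly (diff_op Fs (mat ([:- y, 1:] ^ n) ** M) $ i $ j) y = fact n * poly ((M ** (Fs ! n)) $ i $ j) y"
proof -
  have van: "poly ((pderiv ^^ l) ([:- y, 1:] ^ n * f)) y = (if l = n then fact n * poly f y else 0)"
    if "l < Suc n" for l f
  proof -
    have "l \<le> n" using that by simp
    from higher_pderiv_power_mult[OF this, of y f]
    obtain g where "(pderiv ^^ l) ([:- y, 1:] ^ n * f) = [:- y, 1:] ^ (n - l) * g"
      "fact (n - l) * poly g y = fact n * poly f y" by blast
    then show ?thesis using that by auto
  qed
  have "poly (diff_op Fs (mat ([:- y, 1:] ^ n) ** M) $ i $ j) y =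
      (\<Sum>l<Suc n. poly ((pderiv ^^ l) ([:- y, 1:] ^ n * M $ i $ 1)) y * poly (Fs ! l $ 1 $ j) y +
        poly ((pderiv ^^ l) ([:- y, 1:] ^ n * M $ i $ 2)) y * poly (Fs ! l $ 2 $ j) y)"
    by (simp only: diff_op_def assms sum_component matrix_mult_nth2[of "(mderiv ^^ _) _"] mderiv_pow_nth
        mat_mult_nth poly_sum poly_add poly_mult)
  also have "\<dots> = (\<Sum>l<Suc n. if l = n then fact n * poly ((M ** (Fs ! n)) $ i $ j) y else 0)"
    by (intro sum.cong refl) (simp add: van matrix_mult_nth2 distrib_left mult.assoc)
  also have "\<dots> = fact n * poly ((M ** (Fs ! n)) $ i $ j) y"
    by (simp add: sum.delta)
  finally show ?thesis .
qed

context jacobi_parameters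
begin

section \<open>Operators with constant eigenvalues\<close>

lemma N1_V1: "N1 ** V1 = mat [:1, 0, -1:]"
  by (rule mat2_eqI) (simp_all add: matrix_mult_nth2 V1_def N1_def lin_def mat_nth algebra_simps)

lemma V1_cancel:
  fixes F :: mpoly
  assumes "V1 ** F = 0"
  shows "F = 0"
proof -
  have "mat [:1, 0, -1:] ** F = 0"
    using assms unfolding N1_V1[symmetric] by (simp flip: matrix_mul_assoc)
  then have "(mat [:1, 0, -1:] ** F) $ i $ j = 0" for i j
    by simp
  then have "[:1, 0, -1:] * F $ i $ j = 0" for i j
    unfolding mat_mult_nth .
  then have "F $ i $ j = 0" for i j
    unfolding mult_eq_0_iff by simp
  then show ?thesis by (simp add: vec_eq_iff)
qed

text \<open>If \<open>F\<close> is the leading coefficient, in order at least one, then the left-hand side has the leading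
  coefficient \<open>V1 ** F\<close> in an order at least two, while the right-hand side has order one. As \<open>V1\<close> can be
  cancelled, \<open>F\<close> vanishes and the order drops.\<close>

lemma intertwining_order_zero:
  assumes "\<And>P. diff_op Fs (op_V \<alpha> \<beta> v P) = op_V \<alpha> \<beta> v (P ** const_mpoly q)"
  shows "\<exists>F. \<forall>P. diff_op Fs P = P ** F"
  using assms
proof (induction Fs rule: rev_induct)
  case Nil
  then show ?case by (intro exI[of _ 0]) (simp add: diff_op_def)
next
  case (snoc F Fs)
  show ?case
  proof (cases "length Fs")
    case 0
    then show ?thesis by (intro exI[of _ F]) (simp add: diff_op_def)
  next
    case (Suc m)
    define n where "n = Suc m"
    have "poly ((V1 ** F) $ i $ j) y = 0" for i j y
    proof -
      \<comment> \<open>\<open>op_V\<close> lowers the order of vanishing at \<open>y\<close> by one, so the exponent has to exceed the order \<open>n\<close>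
        of the operator by one.\<close>
      define u where "u = [:- y, 1:] ^ Suc n"
      have du: "pderiv u = [:- y, 1:] ^ n * [:of_nat (Suc n):]"
        by (simp add: u_def pderiv_power_Suc pderiv_pCons del: power_Suc)
      have mderiv_u: "mderiv (mat u) = mat (pderiv u)"
        by (rule mat2_eqI) (simp_all add: mat_nth)
      define M where "M = mat [:- y, 1:] ** const_mpoly V0 + mat [:of_nat (Suc n):] ** V1"
      have "op_V \<alpha> \<beta> v (mat u) = mat ([:- y, 1:] ^ n) ** M"
        unfolding op_V_apply mderiv_u du
        by (rule mat2_eqI) (simp_all add: M_def u_def algebra_simps del: const_mpoly_nth)
      moreover have "poly (op_V \<alpha> \<beta> v (mat u ** const_mpoly q) $ i $ j) y = 0"
      proof -
        have "poly u y = 0" "poly (pderiv u) y = 0"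
          by (simp_all add: du, simp_all add: u_def n_def)
        then show ?thesis
          by (simp add: op_V_apply mderiv_mult mderiv_u matrix_mul_assoc[symmetric])
      qed
      ultimately have "poly (diff_op (Fs @ [F]) (mat ([:- y, 1:] ^ n) ** M) $ i $ j) y = 0"
        using snoc.prems[of "mat u"] by simp
      moreover have "(Fs @ [F]) ! n = F" using Suc by (simp add: n_def nth_append)
      moreover have len: "length (Fs @ [F]) = Suc n" using Suc by (simp add: n_def)
      ultimately have "poly ((M ** F) $ i $ j) y = 0"
        using diff_op_leading_coefficient[OF len, of y M i j] by (simp del: length_append)
      moreover have "poly ((M ** F) $ i $ j) y = of_nat (Suc n) * poly ((V1 ** F) $ i $ j) y"
        by (simp add: M_def matrix_add_rdistrib' flip: matrix_mul_assoc)
      ultimately show ?thesis by (simp del: of_nat_Suc)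
    qed
    then have "(V1 ** F) $ i $ j = 0" for i j
      using poly_all_0_iff_0 by blast
    then have "V1 ** F = 0" by (simp add: vec_eq_iff)
    then have "F = 0" by (rule V1_cancel)
    then have eq: "diff_op (Fs @ [F]) = diff_op Fs"
      by (simp add: diff_op_def fun_eq_iff nth_append)
    show ?thesis
      unfolding eq by (rule snoc.IH) (use snoc.prems in \<open>simp add: eq\<close>)
  qed
qed

text \<open>Left linearity is part of this notion because it makes the eigenvalues determine the operator, as
  \<open>has_eigenvalues_unique\<close> states.\<close>

definition has_eigenvalues :: "mop \<Rightarrow> (nat \<Rightarrow> cmat) \<Rightarrow> bool" where
  "has_eigenvalues D \<Lambda> \<longleftrightarrow> left_linear D \<and> (\<forall>n. D (matrix_OP n) = const_mpoly (\<Lambda> n) ** matrix_OP n)"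

lemma has_eigenvalues_unique:
  assumes "has_eigenvalues D \<Lambda>" "has_eigenvalues E \<Lambda>"
  shows "D = E"
  using assms by (intro left_linear_eqI[OF matrix_OP_monic]) (auto simp: has_eigenvalues_def)

lemma has_eigenvalues_add:
  "has_eigenvalues D \<Lambda> \<Longrightarrow> has_eigenvalues E M \<Longrightarrow> has_eigenvalues (op_add D E) (\<lambda>n. \<Lambda> n + M n)"
  by (auto simp: has_eigenvalues_def op_add_def left_linear_def const_mpoly_add matrix_add_rdistrib'
      matrix_add_ldistrib)

lemma has_eigenvalues_scale:
  assumes "has_eigenvalues D \<Lambda>"
  shows "has_eigenvalues (op_scale c D) (\<lambda>n. mat c ** \<Lambda> n)"
proof -
  have "left_linear (op_scale c D)"
    using assms left_linear_right_mult[of D "const_mpoly (mat c)"]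
    by (simp add: has_eigenvalues_def op_scale_conv_right[abs_def])
  then show ?thesis
    using assms by (simp add: has_eigenvalues_def op_scale_conv const_mpoly_mult matrix_mul_assoc)
qed

lemma has_eigenvalues_mult:
  "has_eigenvalues D \<Lambda> \<Longrightarrow> has_eigenvalues E M \<Longrightarrow> has_eigenvalues (D \<star> E) (\<lambda>n. \<Lambda> n ** M n)"
  using left_linear_comp[of D E]
  by (simp add: has_eigenvalues_def op_mult_def comp_def left_linear_const const_mpoly_mult matrix_mul_assoc)

lemma has_eigenvalues_zero: "has_eigenvalues (\<lambda>P. 0) (\<lambda>n. 0)"
  by (simp add: has_eigenvalues_def left_linear_def)

lemma has_eigenvalues_one: "has_eigenvalues (const_op (mat 1)) (\<lambda>n. mat 1)"
  by (simp add: has_eigenvalues_def const_op_apply[abs_def] left_linear_def)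

lemma has_eigenvalues_sandwich:
  "has_eigenvalues (op_N \<alpha> \<beta> v \<star> const_op E \<star> op_V \<alpha> \<beta> v) (\<lambda>n. eigen_A n ** E ** eigen_B n)"
proof -
  have comm: "scalar_OP n ** const_mpoly E = const_mpoly E ** scalar_OP n" for n
    by (simp add: mat_central)
  have "left_linear (const_op E)" by (simp add: const_op_def left_linear_diff_op)
  then have "left_linear (op_N \<alpha> \<beta> v \<star> const_op E \<star> op_V \<alpha> \<beta> v)"
    using left_linear_comp[OF left_linear_comp[OF op_linear(2)] op_linear(1)] by (simp add: op_mult_def comp_def)
  then show ?thesis
    by (simp add: has_eigenvalues_def op_mult_apply op_N_matrix_OP const_op_apply left_linear_const[OF op_linear(1)]
        op_V_scalar_OP const_mpoly_mult comm flip: matrix_mul_assoc)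
qed

lemma scalar_OP_monic: "monic_of_degree n (scalar_OP n)"
  using coeff_monic_jacobi_poly[OF exponents]
  by (auto simp: monic_of_degree_def vec_eq_iff mat_nth)

text \<open>With these eigenvalues \<open>D\<close> satisfies the hypothesis of \<open>intertwining_order_zero\<close>, so it is
  multiplication by a constant diagonal matrix on the right. This matrix commutes with \<open>V1\<close>, whose
  off-diagonal entries do not vanish, and is therefore scalar.\<close>

lemma constant_eigenvalues_scalar:
  assumes D: "D \<in> diff_ops" and eig: "has_eigenvalues D (\<lambda>n. mat2 q1 0 0 q2)"
  shows "q1 = q2"
proof -
  let ?q = "mat2 q1 0 0 q2 :: cmat"
  obtain Fs where Fs: "D = diff_op Fs" using D by (auto simp: diff_ops_def)
  have lin: "left_linear D" and DR: "D (matrix_OP n) = const_mpoly ?q ** matrix_OP n" for n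
    using eig by (simp_all add: has_eigenvalues_def)
  have "(\<lambda>P. D (op_V \<alpha> \<beta> v P)) = (\<lambda>P. op_V \<alpha> \<beta> v (P ** const_mpoly ?q))"
  proof (rule left_linear_eqI[OF scalar_OP_monic])
    show "left_linear (\<lambda>P. D (op_V \<alpha> \<beta> v P))"
      by (rule left_linear_comp[OF op_linear(1) lin])
    show "left_linear (\<lambda>P. op_V \<alpha> \<beta> v (P ** const_mpoly ?q))"
      using left_linear_comp[OF left_linear_right_mult[of "\<lambda>P. P" "const_mpoly ?q"] op_linear(1)]
      by (simp add: left_linear_def)
    fix n
    have "eigen_B n ** ?q = ?q ** eigen_B n"
      by (rule mat2_eqI) (simp_all add: matrix_mult_nth2 eigen_B_def)
    moreover have "scalar_OP n ** const_mpoly ?q = const_mpoly ?q ** scalar_OP n"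
      by (simp add: mat_central)
    ultimately show "D (op_V \<alpha> \<beta> v (scalar_OP n)) = op_V \<alpha> \<beta> v (scalar_OP n ** const_mpoly ?q)"
      by (simp add: op_V_scalar_OP left_linear_const[OF lin] left_linear_const[OF op_linear(1)] DR
          matrix_mul_assoc flip: const_mpoly_mult)
  qed
  then have DV: "D (op_V \<alpha> \<beta> v P) = op_V \<alpha> \<beta> v (P ** const_mpoly ?q)" for P
    by (rule fun_cong)
  obtain F where F: "\<And>P. D P = P ** F"
    using intertwining_order_zero[of Fs ?q] DV unfolding Fs by auto
  \<comment> \<open>The value of \<open>D\<close> at the orthogonal polynomial of degree zero identifies \<open>F\<close>; the polynomial \<open>x\<close> then
    detects the off-diagonal entry \<open>1 + k\<close> of \<open>V1\<close>.\<close>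
  have "matrix_OP 0 = mat 1"
    using matrix_OP_monic[of 0]
    by (intro mpoly_eqI)
      (auto simp: monic_of_degree_def vec_eq_iff mat_nth gr0_conv_Suc coeff_eq_0 coeff_1 split: nat.splits)
  then have "F = const_mpoly ?q" using DR[of 0] F[of "matrix_OP 0"] by simp
  then have "op_V \<alpha> \<beta> v (mat [:0, 1:]) ** const_mpoly ?q = op_V \<alpha> \<beta> v (mat [:0, 1:] ** const_mpoly ?q)"
    using DV F by simp
  then have "coeff ((op_V \<alpha> \<beta> v (mat [:0, 1:]) ** const_mpoly ?q) $ 1 $ 2) 0 =
     coeff (op_V \<alpha> \<beta> v (mat [:0, 1:] ** const_mpoly ?q) $ 1 $ 2) 0" by simp
  then have "(1 + complex_of_real k) * q2 = (1 + complex_of_real k) * q1"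
    by (simp add: op_V_apply matrix_mult_nth2 mat_nth V0_def V1_def rmat2_def lin_def pderiv_pCons algebra_simps)
  moreover have "1 + complex_of_real k \<noteq> 0"
  proof -
    have "1 + k \<noteq> 0" using k_bound by auto
    then show ?thesis using of_real_eq_0_iff[of "1 + k", where ?'a = complex] by simp
  qed
  ultimately show ?thesis by simp
qed


section \<open>The generated algebra\<close>

abbreviation sandwich :: "cmat \<Rightarrow> mop" where
  "sandwich E \<equiv> op_N \<alpha> \<beta> v \<star> const_op E \<star> op_V \<alpha> \<beta> v"

definition sandwich_algebra :: "mop set" where
  "sandwich_algebra = generated_algebra {const_op (mat 1), sandwich (mat2 1 0 0 0), sandwich (mat2 0 1 0 0),
     sandwich (mat2 0 0 1 0), sandwich (mat2 0 0 0 1)}"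

lemma generated_generators:
  "const_op (mat 1) \<in> sandwich_algebra" "sandwich (mat2 1 0 0 0) \<in> sandwich_algebra" "sandwich (mat2 0 1 0 0) \<in> sandwich_algebra"
  "sandwich (mat2 0 0 1 0) \<in> sandwich_algebra" "sandwich (mat2 0 0 0 1) \<in> sandwich_algebra"
  by (auto simp: sandwich_algebra_def intro: generated_algebra.incl)

lemma generated_closed:
  "D \<in> sandwich_algebra \<Longrightarrow> E \<in> sandwich_algebra \<Longrightarrow> op_add D E \<in> sandwich_algebra"
  "D \<in> sandwich_algebra \<Longrightarrow> op_scale c D \<in> sandwich_algebra"
  "D \<in> sandwich_algebra \<Longrightarrow> E \<in> sandwich_algebra \<Longrightarrow> D \<star> E \<in> sandwich_algebra"
  by (auto simp: sandwich_algebra_def intro: generated_algebra.intros)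

lemma weight_algebra_iff:
  "D \<in> weight_algebra (jacobi_weight \<alpha> \<beta> v) \<longleftrightarrow> D \<in> diff_ops \<and> (\<exists>\<Lambda>. has_eigenvalues D \<Lambda>)"
  unfolding weight_algebra_def monic_OP_eq has_eigenvalues_def
  by (auto simp: left_linear_diff_ops choice_iff)

lemma sandwich_diff_ops: "sandwich E \<in> diff_ops"
  by (intro diff_ops_mult const_op_diff_ops) (simp_all add: op_N_def op_V_def diff_ops_def)

lemma generated_subset: "sandwich_algebra \<subseteq> weight_algebra (jacobi_weight \<alpha> \<beta> v)"
proof
  fix D assume "D \<in> sandwich_algebra"
  then have "D \<in> diff_ops \<and> (\<exists>\<Lambda>. has_eigenvalues D \<Lambda>)"
    unfolding sandwich_algebra_def
  proof induction
    case (incl D)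
    then show ?case
      using has_eigenvalues_one has_eigenvalues_sandwich sandwich_diff_ops const_op_diff_ops by blast
  next
    case zero
    then show ?case using has_eigenvalues_zero diff_ops_zero by blast
  next
    case (add D E)
    then have "op_add D E \<in> diff_ops" using diff_ops_add[of D E] by (simp add: op_add_def)
    then show ?case using add has_eigenvalues_add by blast
  next
    case (scale D c)
    then show ?case using has_eigenvalues_scale diff_ops_scale by blast
  next
    case (mult D E)
    then show ?case using has_eigenvalues_mult diff_ops_mult by blast
  qed
  then show "D \<in> weight_algebra (jacobi_weight \<alpha> \<beta> v)" by (simp add: weight_algebra_iff)
qed

abbreviation jacobi_ev :: "nat \<Rightarrow> complex" where "jacobi_ev \<equiv> jacobi_eigenvalue \<alpha> \<beta>"

definition matrix_unit :: "2 \<Rightarrow> 2 \<Rightarrow> cmat" where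
  "matrix_unit i j = (\<chi> a b. if a = i \<and> b = j then 1 else 0)"

lemma matrix_unit_eq:
  "matrix_unit 1 1 = mat2 1 0 0 0" "matrix_unit 1 2 = mat2 0 1 0 0"
  "matrix_unit 2 1 = mat2 0 0 1 0" "matrix_unit 2 2 = mat2 0 0 0 1"
  by (auto intro!: mat2_eqI simp: matrix_unit_def)

lemma sandwich_unit_generated: "sandwich (matrix_unit i j) \<in> sandwich_algebra"
  using exhaust_2[of i] exhaust_2[of j] generated_generators by (auto simp: matrix_unit_eq)

lemma diagonal_sandwich:
  "(eigen_A n ** M ** eigen_B n) $ i $ j = eigen_A n $ i $ i * M $ i $ j * eigen_B n $ j $ j"
  "(eigen_B n ** M ** eigen_A n) $ i $ j = eigen_B n $ i $ i * M $ i $ j * eigen_A n $ j $ j"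
  using exhaust_2[of i] exhaust_2[of j] by (auto simp: matrix_mult_nth2 eigen_A_def eigen_B_def)

text \<open>The value of \<open>\<lambda>\<^sub>n\<close> at which the \<open>i\<close>-th diagonal entry of \<open>B\<^sub>n A\<^sub>n\<close> would vanish.\<close>

definition eigen_root :: "2 \<Rightarrow> complex" where
  "eigen_root i = (V0 ** N0) $ i $ i"

lemma eigen_B_A_nth: "eigen_B n $ i $ i * eigen_A n $ i $ i = eigen_root i - jacobi_ev n"
proof -
  have "(eigen_B n ** eigen_A n) $ i $ i = eigen_B n $ i $ i * eigen_A n $ i $ i"
    using exhaust_2[of i] by (auto simp: matrix_mult_nth2 eigen_A_def eigen_B_def)
  then show ?thesis by (simp add: eigen_B_A eigen_root_def mat_nth)
qed

text \<open>Multiplication on the right by the generator for the matrix unit with indices \<open>j\<close>, \<open>j\<close> multiplies the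
  polynomial \<open>g\<close> by \<open>r\<^sub>j - X\<close>. Linear combinations then give multiplication by \<open>X\<close>.\<close>

lemma generated_unit_polynomial:
  "\<exists>G\<in>sandwich_algebra. has_eigenvalues G (\<lambda>n. eigen_A n ** (mat (poly g (jacobi_ev n)) ** matrix_unit i j) ** eigen_B n)"
proof (induction g)
  case 0
  have "(\<lambda>P. 0) \<in> sandwich_algebra" by (simp add: sandwich_algebra_def generated_algebra.zero)
  moreover have "(\<lambda>n. eigen_A n ** (mat (poly 0 (jacobi_ev n)) ** matrix_unit i j) ** eigen_B n) = (\<lambda>n. 0)"
    by (simp add: fun_eq_iff vec_eq_iff diagonal_sandwich)
  ultimately show ?case using has_eigenvalues_zero by metis
next
  case (pCons c g)
  then obtain G where G: "G \<in> sandwich_algebra"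
    "has_eigenvalues G (\<lambda>n. eigen_A n ** (mat (poly g (jacobi_ev n)) ** matrix_unit i j) ** eigen_B n)"
    by blast
  define H where "H = op_add (op_scale c (sandwich (matrix_unit i j)))
    (op_add (op_scale (eigen_root j) G) (op_scale (-1) (G \<star> sandwich (matrix_unit j j))))"
  have "H \<in> sandwich_algebra" unfolding H_def by (intro generated_closed sandwich_unit_generated G)
  moreover have "has_eigenvalues H (\<lambda>n.
      mat c ** (eigen_A n ** matrix_unit i j ** eigen_B n) +
      (mat (eigen_root j) ** (eigen_A n ** (mat (poly g (jacobi_ev n)) ** matrix_unit i j) ** eigen_B n) +
       mat (-1) ** ((eigen_A n ** (mat (poly g (jacobi_ev n)) ** matrix_unit i j) ** eigen_B n) **
          (eigen_A n ** matrix_unit j j ** eigen_B n))))" (is "has_eigenvalues H ?\<Lambda>")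
    unfolding H_def
    by (intro has_eigenvalues_add has_eigenvalues_scale has_eigenvalues_mult has_eigenvalues_sandwich G)
  moreover have "?\<Lambda> n = eigen_A n ** (mat (poly (pCons c g) (jacobi_ev n)) ** matrix_unit i j) ** eigen_B n" for n
  proof -
    have "?\<Lambda> n $ a $ b = (eigen_A n ** (mat (poly (pCons c g) (jacobi_ev n)) ** matrix_unit i j) ** eigen_B n) $ a $ b" for a b
    proof -
      have eq: "eigen_root j = eigen_B n $ j $ j * eigen_A n $ j $ j + jacobi_ev n"
        by (simp add: eigen_B_A_nth)
      show ?thesis
        unfolding vector_add_component mat_mult_nth matrix_mult_nth2[of "eigen_A n ** _ ** eigen_B n"] diagonal_sandwich eq
        using exhaust_2[of j] by (auto simp: matrix_unit_def algebra_simps)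
    qed
    then show ?thesis by (simp add: vec_eq_iff)
  qed
  ultimately show ?case by auto
qed

lemma generated_matrix_polynomial:
  fixes M :: mpoly
  shows "\<exists>G\<in>sandwich_algebra. has_eigenvalues G (\<lambda>n. eigen_A n ** (\<chi> i j. poly (M $ i $ j) (jacobi_ev n)) ** eigen_B n)"
proof -
  define \<Lambda> where "\<Lambda> i j n = eigen_A n ** (mat (poly (M $ i $ j) (jacobi_ev n)) ** matrix_unit i j) ** eigen_B n" for i j n
  have "\<exists>G. G \<in> sandwich_algebra \<and> has_eigenvalues G (\<Lambda> i j)" for i j
    using generated_unit_polynomial[of "M $ i $ j" i j] by (auto simp: \<Lambda>_def[abs_def])
  then obtain G where G: "\<And>i j. G i j \<in> sandwich_algebra" "\<And>i j. has_eigenvalues (G i j) (\<Lambda> i j)"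
    by metis
  define H where "H = op_add (op_add (G 1 1) (G 1 2)) (op_add (G 2 1) (G 2 2))"
  have "H \<in> sandwich_algebra" unfolding H_def by (intro generated_closed G)
  moreover have "has_eigenvalues H (\<lambda>n. (\<Lambda> 1 1 n + \<Lambda> 1 2 n) + (\<Lambda> 2 1 n + \<Lambda> 2 2 n))"
    unfolding H_def by (intro has_eigenvalues_add G)
  moreover have "(\<Lambda> 1 1 n + \<Lambda> 1 2 n) + (\<Lambda> 2 1 n + \<Lambda> 2 2 n) =
      eigen_A n ** (\<chi> i j. poly (M $ i $ j) (jacobi_ev n)) ** eigen_B n" for n
    by (rule mat2_eqI) (simp_all add: \<Lambda>_def diagonal_sandwich matrix_unit_def)
  ultimately show ?thesis by auto
qed


section \<open>Every operator of the algebra is generated\<close>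

lemma poly_eq_of_nat:
  fixes f g :: "complex poly"
  assumes "\<And>n. poly f (of_nat n) = poly g (of_nat n)"
  shows "f = g"
proof (rule ccontr)
  assume "f \<noteq> g"
  then have "finite {x. poly (f - g) x = 0}" by (intro poly_roots_finite) simp
  moreover have "range (of_nat :: nat \<Rightarrow> complex) \<subseteq> {x. poly (f - g) x = 0}"
    using assms by auto
  ultimately have "finite (range (of_nat :: nat \<Rightarrow> complex))" by (rule finite_subset[rotated])
  then show False
    using finite_imageD[of "of_nat :: nat \<Rightarrow> complex" UNIV] by (simp add: inj_on_def)
qed

definition poly_B :: "2 \<Rightarrow> complex poly" where
  "poly_B i = (if i = 1 then [:of_real ((2 + s + v) / 2), 1:] else [:of_real ((2 + s - v) / 2), 1:])"

definition poly_A :: "2 \<Rightarrow> complex poly" where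
  "poly_A i = (if i = 1 then - [:of_real ((4 + s - v) / 2), 1:] else - [:of_real ((4 + s + v) / 2), 1:])"

definition poly_eig :: "complex poly" where
  "poly_eig = [:0, of_real (s + 3), 1:]"

lemma poly_at_nat:
  "poly (poly_B i) (of_nat n) = eigen_B n $ i $ i" "poly (poly_A i) (of_nat n) = eigen_A n $ i $ i"
  "poly poly_eig (of_nat n) = jacobi_ev n"
  using exhaust_2[of i]
  by (auto simp: poly_B_def poly_A_def poly_eig_def eigen_A_def eigen_B_def jacobi_eigenvalue_def s_def algebra_simps)

lemma poly_B_A: "poly_B i * poly_A i = [:eigen_root i:] - poly_eig"
  by (rule poly_eq_of_nat) (simp add: poly_at_nat eigen_B_A_nth)

lemma eigen_root_distinct: "eigen_root 1 \<noteq> eigen_root 2"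
proof -
  have "eigen_root 1 - eigen_root 2 = - of_real v"
    by (simp add: eigen_root_def matrix_mult_nth2 V0_def N0_def rmat2_def field_simps)
  moreover have "- complex_of_real v \<noteq> 0" using v_nonzero by simp
  ultimately show ?thesis by (metis diff_self)
qed

text \<open>The hypothesis is a polynomial identity in \<open>n\<close>, hence it holds at the complex root of either
  linear factor. There the left-hand side vanishes, and by \<open>poly_B_A\<close> the argument of \<open>G\<close> is the
  corresponding \<open>eigen_root\<close>.\<close>

lemma product_polynomial_roots:
  fixes L G :: "complex poly"
  assumes "\<And>n. eigen_B n $ i $ i * poly L (of_nat n) * eigen_A n $ j $ j = poly G (jacobi_ev n)"
  shows "poly G (eigen_root i) = 0" "poly G (eigen_root j) = 0"
proof -
  have "poly_B i * L * poly_A j = pcompose G poly_eig"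
    by (rule poly_eq_of_nat) (simp add: poly_pcompose poly_at_nat assms)
  then have eq: "poly (poly_B i) x * poly L x * poly (poly_A j) x = poly G (poly poly_eig x)" for x
    by (metis poly_mult poly_pcompose)
  have root: "poly poly_eig x = eigen_root l" if "poly (poly_B l) x = 0 \<or> poly (poly_A l) x = 0" for l x
  proof -
    have "poly (poly_B l * poly_A l) x = 0" using that by auto
    then show ?thesis unfolding poly_B_A poly_diff by simp
  qed
  obtain x where x: "poly (poly_B i) x = 0"
    by (cases "i = 1") (auto simp: poly_B_def add_eq_0_iff)
  then show "poly G (eigen_root i) = 0" using eq[of x] root[of i x] by simp
  obtain y where y: "poly (poly_A j) y = 0"
    by (cases "j = 1") (auto simp: poly_A_def add_eq_0_iff)
  then show "poly G (eigen_root j) = 0" using eq[of y] root[of j y] by simp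
qed

text \<open>One factor of \<open>G\<close> cancels against \<open>B\<^sub>n A\<^sub>n\<close>. Dividing the quotient once more by the same linear
  factor leaves the remainder \<open>q\<close>.\<close>

lemma diagonal_eigenvalue:
  fixes L G :: "complex poly"
  assumes "\<And>n. eigen_B n $ i $ i * poly L (of_nat n) * eigen_A n $ i $ i = poly G (jacobi_ev n)"
  shows "\<exists>q M. \<forall>n. poly L (of_nat n) = q + eigen_A n $ i $ i * poly M (jacobi_ev n) * eigen_B n $ i $ i"
proof -
  have nz: "eigen_B n $ i $ i * eigen_A n $ i $ i \<noteq> 0" for n
    using eigen_nonzero[of n] exhaust_2[of i] by auto
  obtain H where H: "G = [:- eigen_root i, 1:] * H"
    using product_polynomial_roots(1)[OF assms] by (metis poly_eq_0_iff_dvd dvdE)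
  have "poly (H - [:poly H (eigen_root i):]) (eigen_root i) = 0" by simp
  then obtain K where K: "H - [:poly H (eigen_root i):] = [:- eigen_root i, 1:] * K"
    by (metis poly_eq_0_iff_dvd dvdE)
  have "poly L (of_nat n) = - poly H (eigen_root i) + eigen_A n $ i $ i * poly K (jacobi_ev n) * eigen_B n $ i $ i" for n
  proof -
    have BA: "jacobi_ev n - eigen_root i = - (eigen_B n $ i $ i * eigen_A n $ i $ i)"
      by (simp add: eigen_B_A_nth)
    have "poly H (jacobi_ev n) - poly H (eigen_root i) = (jacobi_ev n - eigen_root i) * poly K (jacobi_ev n)"
      using arg_cong[OF K, of "\<lambda>f. poly f (jacobi_ev n)"] by (simp add: algebra_simps)
    moreover have "(eigen_B n $ i $ i * eigen_A n $ i $ i) * poly L (of_nat n) =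
        (eigen_B n $ i $ i * eigen_A n $ i $ i) * (- poly H (jacobi_ev n))"
    proof -
      have "poly G (jacobi_ev n) = (jacobi_ev n - eigen_root i) * poly H (jacobi_ev n)"
        by (simp add: H algebra_simps)
      then show ?thesis using assms[of n] unfolding BA by (simp add: algebra_simps)
    qed
    then have "poly L (of_nat n) = - poly H (jacobi_ev n)" by (rule mult_left_cancel[OF nz, THEN iffD1])
    ultimately show ?thesis unfolding BA by (simp add: algebra_simps)
  qed
  then show ?thesis by blast
qed

text \<open>The two roots are distinct, so \<open>G\<close> is divisible by both linear factors, and these supply exactly
  the entries of \<open>A\<^sub>n\<close> and \<open>B\<^sub>n\<close> on the right-hand side.\<close>

lemma offdiagonal_eigenvalue:
  fixes L G :: "complex poly"
  assumes "i \<noteq> j" and "\<And>n. eigen_B n $ i $ i * poly L (of_nat n) * eigen_A n $ j $ j = poly G (jacobi_ev n)"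
  shows "\<exists>M. \<forall>n. poly L (of_nat n) = eigen_A n $ i $ i * poly M (jacobi_ev n) * eigen_B n $ j $ j"
proof -
  have nz: "eigen_B n $ i $ i * eigen_A n $ j $ j \<noteq> 0" for n
    using eigen_nonzero[of n] exhaust_2[of i] exhaust_2[of j] by auto
  have distinct: "eigen_root i \<noteq> eigen_root j"
    using \<open>i \<noteq> j\<close> eigen_root_distinct exhaust_2[of i] exhaust_2[of j] by auto
  obtain H where H: "G = [:- eigen_root i, 1:] * H"
    using product_polynomial_roots(1)[OF assms(2)] by (metis poly_eq_0_iff_dvd dvdE)
  have "poly H (eigen_root j) = 0"
    using product_polynomial_roots(2)[OF assms(2)] distinct by (simp add: H)
  then obtain M where M: "H = [:- eigen_root j, 1:] * M"
    by (metis poly_eq_0_iff_dvd dvdE)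
  have "poly L (of_nat n) = eigen_A n $ i $ i * poly M (jacobi_ev n) * eigen_B n $ j $ j" for n
  proof -
    have BA: "jacobi_ev n - eigen_root l = - (eigen_B n $ l $ l * eigen_A n $ l $ l)" for l
      by (simp add: eigen_B_A_nth)
    have "poly G (jacobi_ev n) = (jacobi_ev n - eigen_root i) * ((jacobi_ev n - eigen_root j) * poly M (jacobi_ev n))"
      by (simp add: H M algebra_simps)
    then have "(eigen_B n $ i $ i * eigen_A n $ j $ j) * poly L (of_nat n) =
      (eigen_B n $ i $ i * eigen_A n $ j $ j) * (eigen_A n $ i $ i * poly M (jacobi_ev n) * eigen_B n $ j $ j)"
      using assms(2)[of n] unfolding BA by (simp add: algebra_simps)
    then show ?thesis by (rule mult_left_cancel[OF nz, THEN iffD1])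
  qed
  then show ?thesis by blast
qed

lemma eigenvalue_decomposition:
  assumes D: "D \<in> diff_ops" and eig: "has_eigenvalues D \<Lambda>"
  shows "\<exists>q1 q2 (M :: mpoly). \<forall>n. \<Lambda> n = mat2 q1 0 0 q2 + eigen_A n ** (\<chi> i j. poly (M $ i $ j) (jacobi_ev n)) ** eigen_B n"
proof -
  have lin: "left_linear D" and DR: "D (matrix_OP n) = const_mpoly (\<Lambda> n) ** matrix_OP n" for n
    using eig by (simp_all add: has_eigenvalues_def)
  obtain L :: mpoly where L: "\<And>n i j. \<Lambda> n $ i $ j = poly (L $ i $ j) (of_nat n)"
    using leading_eigenvalues_polynomial[OF matrix_OP_monic D DR] by blast
  have "op_V \<alpha> \<beta> v \<star> D \<star> op_N \<alpha> \<beta> v \<in> diff_ops"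
    by (intro diff_ops_mult D) (simp_all add: op_N_def op_V_def diff_ops_def)
  moreover have "(op_V \<alpha> \<beta> v \<star> D \<star> op_N \<alpha> \<beta> v) (scalar_OP n) = const_mpoly (eigen_B n ** \<Lambda> n ** eigen_A n) ** scalar_OP n" for n
    by (simp add: op_mult_apply op_V_scalar_OP left_linear_const[OF lin] left_linear_const[OF op_linear(2)] DR
        op_N_matrix_OP const_mpoly_mult flip: matrix_mul_assoc)
  ultimately obtain G :: mpoly where
    "\<And>n i j. (eigen_B n ** \<Lambda> n ** eigen_A n) $ i $ j = poly (G $ i $ j) (jacobi_ev n)"
    using monic_jacobi_eigenvalues_polynomial[OF exponents, of "op_V \<alpha> \<beta> v \<star> D \<star> op_N \<alpha> \<beta> v"
        "\<lambda>n. eigen_B n ** \<Lambda> n ** eigen_A n"] by blast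
  then have G: "eigen_B n $ i $ i * poly (L $ i $ j) (of_nat n) * eigen_A n $ j $ j = poly (G $ i $ j) (jacobi_ev n)" for n i j
    by (simp add: diagonal_sandwich L)
  obtain q1 M1 where 1: "\<And>n. poly (L $ 1 $ 1) (of_nat n) = q1 + eigen_A n $ 1 $ 1 * poly M1 (jacobi_ev n) * eigen_B n $ 1 $ 1"
    using diagonal_eigenvalue[OF G] by blast
  obtain q2 M2 where 2: "\<And>n. poly (L $ 2 $ 2) (of_nat n) = q2 + eigen_A n $ 2 $ 2 * poly M2 (jacobi_ev n) * eigen_B n $ 2 $ 2"
    using diagonal_eigenvalue[OF G] by blast
  obtain M12 where 12: "\<And>n. poly (L $ 1 $ 2) (of_nat n) = eigen_A n $ 1 $ 1 * poly M12 (jacobi_ev n) * eigen_B n $ 2 $ 2"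
    using offdiagonal_eigenvalue[OF _ G, of 1 2] by auto
  obtain M21 where 21: "\<And>n. poly (L $ 2 $ 1) (of_nat n) = eigen_A n $ 2 $ 2 * poly M21 (jacobi_ev n) * eigen_B n $ 1 $ 1"
    using offdiagonal_eigenvalue[OF _ G, of 2 1] by auto
  have "\<Lambda> n = mat2 q1 0 0 q2 + eigen_A n ** (\<chi> i j. poly (mat2 M1 M12 M21 M2 $ i $ j) (jacobi_ev n)) ** eigen_B n" for n
    by (rule mat2_eqI) (simp_all add: diagonal_sandwich L 1 2 12 21)
  then show ?thesis by blast
qed

lemma weight_algebra_subset: "weight_algebra (jacobi_weight \<alpha> \<beta> v) \<subseteq> sandwich_algebra"
proof
  fix D assume "D \<in> weight_algebra (jacobi_weight \<alpha> \<beta> v)"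
  then obtain \<Lambda> where D: "D \<in> diff_ops" and eig: "has_eigenvalues D \<Lambda>"
    by (auto simp: weight_algebra_iff)
  obtain q1 q2 M where \<Lambda>:
    "\<And>n. \<Lambda> n = mat2 q1 0 0 q2 + eigen_A n ** (\<chi> i j. poly (M $ i $ j) (jacobi_ev n)) ** eigen_B n"
    using eigenvalue_decomposition[OF D eig] by blast
  obtain G where G: "G \<in> sandwich_algebra"
    "has_eigenvalues G (\<lambda>n. eigen_A n ** (\<chi> i j. poly (M $ i $ j) (jacobi_ev n)) ** eigen_B n)"
    using generated_matrix_polynomial by blast
  have "G \<in> diff_ops" using G(1) generated_subset by (auto simp: weight_algebra_iff)
  then have "op_add D (op_scale (-1) G) \<in> diff_ops"
    using diff_ops_add[OF D diff_ops_scale] by (simp add: op_add_def)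
  moreover have "has_eigenvalues (op_add D (op_scale (-1) G)) (\<lambda>n. mat2 q1 0 0 q2)"
  proof -
    have "\<Lambda> n + mat (-1) ** (eigen_A n ** (\<chi> i j. poly (M $ i $ j) (jacobi_ev n)) ** eigen_B n) = mat2 q1 0 0 q2" for n
      unfolding \<Lambda> by (simp add: vec_eq_iff)
    then show ?thesis
      using has_eigenvalues_add[OF eig has_eigenvalues_scale[OF G(2), of "-1"]] by simp
  qed
  ultimately have q: "q1 = q2" by (rule constant_eigenvalues_scalar)
  have "has_eigenvalues (op_add (op_scale q1 (const_op (mat 1))) G) \<Lambda>"
  proof -
    have "\<Lambda> = (\<lambda>n. mat q1 ** mat 1 + eigen_A n ** (\<chi> i j. poly (M $ i $ j) (jacobi_ev n)) ** eigen_B n)"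
      by (rule ext) (simp add: \<Lambda> q, rule mat2_eqI, simp_all add: mat_nth)
    then show ?thesis
      using has_eigenvalues_add[OF has_eigenvalues_scale[OF has_eigenvalues_one] G(2), of q1] by simp
  qed
  then have "D = op_add (op_scale q1 (const_op (mat 1))) G"
    by (rule has_eigenvalues_unique[OF eig])
  then show "D \<in> sandwich_algebra" by (simp add: generated_closed generated_generators G)
qed

end

theorem theorem7p3:
  fixes \<alpha> \<beta> v :: real and D1 D2 D3 D4 :: mop
  assumes "\<bar>\<alpha> - \<beta>\<bar> < \<bar>v\<bar>" and "\<bar>v\<bar> < \<alpha> + \<beta> + 2"
  defines "D1 \<equiv> op_N \<alpha> \<beta> v \<star> const_op (mat2 1 0 0 0) \<star> op_V \<alpha> \<beta> v"
    and "D2 \<equiv> op_N \<alpha> \<beta> v \<star> const_op (mat2 0 1 0 0) \<star> op_V \<alpha> \<beta> v"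
    and "D3 \<equiv> op_N \<alpha> \<beta> v \<star> const_op (mat2 0 0 1 0) \<star> op_V \<alpha> \<beta> v"
    and "D4 \<equiv> op_N \<alpha> \<beta> v \<star> const_op (mat2 0 0 0 1) \<star> op_V \<alpha> \<beta> v"
  shows "weight_algebra (jacobi_weight \<alpha> \<beta> v) =
           generated_algebra {const_op (mat 1), D1, D2, D3, D4}"
proof -
  interpret jacobi_parameters \<alpha> \<beta> v
    by unfold_locales (fact assms)+
  show ?thesis
    using weight_algebra_subset generated_subset unfolding sandwich_algebra_def D1_def D2_def D3_def D4_def by blast
qed

end
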